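(* Let $p,q$ be positive integers, $n=p+q$, and let $\pi:\mathbf{SL}_n/\mathbf{L}_{p,q}\to\mathbf{SL}_n/\mathbf{P}_{p,q}$ be the canonical projection. Let $I\subseteq\{e_1,\dots,e_n\}$ be a set of $p$ standard basis vectors and let $C_I$ be the corresponding Schubert cell of $\mathbf{SL}_n/\mathbf{P}_{p,q}$. Let $\gamma_I=(c_1\dots c_n)$ be the base clan with $c_i=+$ if $e_i\in I$ and $c_i=-$ if $e_i\notin I$, and let $\Sigma_I$ be the sect of $\gamma_I$. If $R_\gamma$ denotes the $\mathbf{B}_n$-orbit of $\mathbf{SL}_n/\mathbf{L}_{p,q}$ associated to a $(p,q)$-clan $\gamma$, then $$\pi^{-1}(C_I)=\bigsqcup_{\gamma\in\Sigma_I}R_\gamma .$$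
   Context: Everything is over $\mathbb{C}$. $\mathbf{B}_n$ is the group of upper triangular matrices in $\mathbf{SL}_n$; $\mathbf{P}_{p,q}$ is the group of matrices $\begin{bmatrix}x&h\\0&y\end{bmatrix}$ with $x\in\mathbf{GL}_p$, $y\in\mathbf{GL}_q$, $\det x\det y=1$, $h$ a $p\times q$ matrix; $\mathbf{L}_{p,q}\subset\mathbf{P}_{p,q}$ is the subgroup with $h=0$. $\mathbf{Fl}_n=\mathbf{SL}_n/\mathbf{B}_n$ is the variety of full flags in $\mathbb{C}^n$ ($g\mathbf{B}_n$ corresponds to the flag whose $i$-th subspace is the span of the first $i$ columns of $g$); $\langle v_1,\dots,v_n\rangle$ denotes the flag with $i$-th subspace $\mathrm{span}\{v_1,\dots,v_i\}$; $e_1,\dots,e_n$ is the standard basis. $\mathbf{SL}_n/\mathbf{P}_{p,q}$ is identified with the Grassmannian $\mathbf{Gr}(p,n)$ of $p$-planes in $\mathbb{C}^n$ by sending $g\mathbf{P}_{p,q}$ to the span of the first $p$ columns of $g$; the Schubert cell $C_I$ is the $\mathbf{B}_n$-orbit of the $p$-plane $\mathrm{span}(I)$. Clans. A $(p,q)$-clan is a sequence $\gamma=(c_1\dots c_n)$ in which each $c_i$ is $+$, $-$ or a natural number, each natural number that occurs does so exactly twice, and (number of $+$'s) $-$ (number of $-$'s) $=p-q$. Two such sequences that differ only by relabelling the natural numbers (same positions of matching pairs) are identified. The default signed clan of $\gamma$ assigns to each matching pair $c_i=c_j\in\mathbb{N}$, $i<j$, the signature $-$ at position $i$ and $+$ at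 position $j$. The base clan of $\gamma$ is obtained by replacing every natural number by its signature in the default signed clan. The sect of a base clan is the set of all clans having that base clan. Orbits. For a clan $\gamma$ with the default signatures, choose $\sigma\in S_n$ with $1\le\sigma(i)\le p$ if $c_i=+$ or $c_i$ is a number with signature $+$, and $p+1\le\sigma(i)\le n$ otherwise. Put $v_i=e_{\sigma(i)}$ if $c_i=\pm$; if $c_i=c_j\in\mathbb{N}$ ($i\ne j$), put $v_i=e_{\sigma(i)}+e_{\sigma(j)}$ if $c_i$ has signature $+$ and $v_i=-e_{\sigma(i)}+e_{\sigma(j)}$ if $c_i$ has signature $-$. Let $\mathbf{Q}_\gamma=\mathbf{L}_{p,q}\cdot\langle v_1,\dots,v_n\rangle\subset\mathbf{Fl}_n$ (independent of $\sigma$), and let $R_\gamma=\{g^{-1}\mathbf{L}_{p,q}: g\in\mathbf{SL}_n,\ g\mathbf{B}_n\in\mathbf{Q}_\gamma\}$, a $\mathbf{B}_n$-orbit in $\mathbf{SL}_n/\mathbf{L}_{p,q}$. It is known (Yamamoto) that $\gamma\mapsto \mathbf{Q}_\gamma$ is a bijection from the set of $(p,q)$-clans to the set of $\mathbf{L}_{p,q}$-orbits in $\mathbf{Fl}_n$, so $\gamma\mapsto R_\gamma$ is a bijection onto the set of $\mathbf{B}_n$-orbits in $\mathbf{SL}_n/\mathbf{L}_{p,q}$. *)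

theory Defs
  imports
    "HOL-Algebra.Left_Coset"
    "HOL-Library.Disjoint_Sets"
    "Jordan_Normal_Form.Determinant"
    "Jordan_Normal_Form.VS_Connect"
begin

text \<open>
  Rows, columns, positions in a clan and the values of \<open>\<sigma>\<close> are numbered from 0; so the basis
  vector called \<open>e\<^sub>i\<close> in the usual numbering is \<open>unit_vec n (i - 1)\<close>.
\<close>

subsection \<open>Functions on classes\<close>

text \<open>
  The value at a class \<open>X\<close> (a coset, or an equivalence class) of a function \<open>f\<close> of
  representatives. It is meaningful when \<open>f\<close> is constant on \<open>X\<close>.
\<close>

definition on_class :: "('a \<Rightarrow> 'b) \<Rightarrow> 'a set \<Rightarrow> 'b" where
  "on_class f X = the_elem (f ` X)"

subsection \<open>The groups\<close>

definition SL :: "nat \<Rightarrow> complex mat monoid" where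
  "SL n = \<lparr>carrier = {A \<in> carrier_mat n n. det A = 1}, mult = (*), one = 1\<^sub>m n\<rparr>"

definition borel_SL :: "nat \<Rightarrow> complex mat set" where
  "borel_SL n = {A \<in> carrier (SL n). upper_triangular A}"

text \<open>The condition \<open>det x * det y = 1\<close> already makes \<open>x\<close> and \<open>y\<close> invertible.\<close>

definition parabolic_SL :: "nat \<Rightarrow> nat \<Rightarrow> complex mat set" where
  "parabolic_SL p q = {four_block_mat x h (0\<^sub>m q p) y | x h y.
     x \<in> carrier_mat p p \<and> y \<in> carrier_mat q q \<and> h \<in> carrier_mat p q \<and> det x * det y = 1}"

definition levi_SL :: "nat \<Rightarrow> nat \<Rightarrow> complex mat set" where
  "levi_SL p q = {four_block_mat x (0\<^sub>m p q) (0\<^sub>m q p) y | x y.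
     x \<in> carrier_mat p p \<and> y \<in> carrier_mat q q \<and> det x * det y = 1}"

definition proj_LP :: "nat \<Rightarrow> nat \<Rightarrow> complex mat set \<Rightarrow> complex mat set" where
  "proj_LP p q = on_class (\<lambda>g. g <#\<^bsub>SL (p + q)\<^esub> parabolic_SL p q)"

subsection \<open>Flags and subspaces\<close>

abbreviation vspan :: "nat \<Rightarrow> complex vec set \<Rightarrow> complex vec set" where
  "vspan n \<equiv> LinearCombinations.module.span class_ring (module_vec TYPE(complex) n)"

text \<open>A flag is the list of its \<open>n\<close> subspaces, of dimensions \<open>1, \<dots>, n\<close>.\<close>

definition flag :: "nat \<Rightarrow> complex vec list \<Rightarrow> complex vec set list" where
  "flag n vs = map (\<lambda>i. vspan n (set (take i vs))) [1..<Suc n]"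

definition act_space :: "complex mat \<Rightarrow> complex vec set \<Rightarrow> complex vec set" where
  "act_space g V = (\<lambda>v. g *\<^sub>v v) ` V"

definition act_flag :: "complex mat \<Rightarrow> complex vec set list \<Rightarrow> complex vec set list" where
  "act_flag g F = map (act_space g) F"

text \<open>The identifications of \<open>SL n / B\<close> with full flags and of \<open>SL n / P\<close> with \<open>p\<close>-planes.\<close>

definition flag_of_coset :: "nat \<Rightarrow> complex mat set \<Rightarrow> complex vec set list" where
  "flag_of_coset n = on_class (\<lambda>g. flag n (cols g))"

definition plane_of_coset :: "nat \<Rightarrow> nat \<Rightarrow> complex mat set \<Rightarrow> complex vec set" where
  "plane_of_coset p n = on_class (\<lambda>g. vspan n (set (take p (cols g))))"

definition schubert_cell :: "nat \<Rightarrow> nat \<Rightarrow> complex vec set \<Rightarrow> complex mat set set" where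
  "schubert_cell p q I = {X \<in> lcosets\<^bsub>SL (p + q)\<^esub> (parabolic_SL p q).
     \<exists>b\<in>borel_SL (p + q). plane_of_coset p (p + q) X = act_space b (vspan (p + q) I)}"

subsection \<open>Clans\<close>

datatype clan_symbol = PlusSign | MinusSign | Label nat

definition clan_seqs :: "nat \<Rightarrow> nat \<Rightarrow> clan_symbol list set" where
  "clan_seqs p q = {c. length c = p + q \<and>
     (\<forall>a. Label a \<in> set c \<longrightarrow> count_list c (Label a) = 2) \<and>
     int (count_list c PlusSign) - int (count_list c MinusSign) = int p - int q}"

text \<open>Same signs at the same positions, and same positions of matching pairs.\<close>

definition relabelling :: "(clan_symbol list \<times> clan_symbol list) set" where
  "relabelling = {(c, d). length c = length d \<and>
     (\<forall>i<length c. (c ! i = PlusSign \<longleftrightarrow> d ! i = PlusSign) \<and>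
                   (c ! i = MinusSign \<longleftrightarrow> d ! i = MinusSign)) \<and>
     (\<forall>i<length c. \<forall>j<length c. c ! i = c ! j \<longleftrightarrow> d ! i = d ! j)}"

definition clan_of :: "clan_symbol list \<Rightarrow> clan_symbol list set" where
  "clan_of c = relabelling `` {c}"

definition clans :: "nat \<Rightarrow> nat \<Rightarrow> clan_symbol list set set" where
  "clans p q = clan_seqs p q // relabelling"

text \<open>
  The sign itself where \<open>c ! i\<close> is a sign; at a label, the signature of position \<open>i\<close> in the
  default signed clan: \<open>-\<close> at the first and \<open>+\<close> at the second position of a matching pair.
\<close>

definition default_sign :: "clan_symbol list \<Rightarrow> nat \<Rightarrow> clan_symbol" where
  "default_sign c i = (case c ! i of
       PlusSign \<Rightarrow> PlusSign
     | MinusSign \<Rightarrow> MinusSign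
     | Label a \<Rightarrow> if \<exists>j<i. c ! j = Label a then PlusSign else MinusSign)"

definition base_seq :: "clan_symbol list \<Rightarrow> clan_symbol list" where
  "base_seq c = map (default_sign c) [0..<length c]"

definition base_clan :: "clan_symbol list set \<Rightarrow> clan_symbol list set" where
  "base_clan = on_class (\<lambda>c. clan_of (base_seq c))"

definition sect :: "nat \<Rightarrow> nat \<Rightarrow> clan_symbol list set \<Rightarrow> clan_symbol list set set" where
  "sect p q \<beta> = {\<gamma> \<in> clans p q. base_clan \<gamma> = \<beta>}"

definition clan_of_subset :: "nat \<Rightarrow> complex vec set \<Rightarrow> clan_symbol list set" where
  "clan_of_subset n I =
     clan_of (map (\<lambda>i. if unit_vec n i \<in> I then PlusSign else MinusSign) [0..<n])"

subsection \<open>Orbits attached to clans\<close>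

definition admissible :: "nat \<Rightarrow> nat \<Rightarrow> clan_symbol list \<Rightarrow> (nat \<Rightarrow> nat) \<Rightarrow> bool" where
  "admissible p q c \<sigma> \<longleftrightarrow> \<sigma> permutes {0..<p + q} \<and>
     (\<forall>i<p + q. \<sigma> i < p \<longleftrightarrow> default_sign c i = PlusSign)"

definition mate :: "clan_symbol list \<Rightarrow> nat \<Rightarrow> nat" where
  "mate c i = (THE j. j < length c \<and> j \<noteq> i \<and> c ! j = c ! i)"

definition clan_vec :: "nat \<Rightarrow> clan_symbol list \<Rightarrow> (nat \<Rightarrow> nat) \<Rightarrow> nat \<Rightarrow> complex vec" where
  "clan_vec n c \<sigma> i =
     (if c ! i = PlusSign \<or> c ! i = MinusSign then unit_vec n (\<sigma> i)
      else if default_sign c i = PlusSign then unit_vec n (\<sigma> i) + unit_vec n (\<sigma> (mate c i))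
      else - unit_vec n (\<sigma> i) + unit_vec n (\<sigma> (mate c i)))"

definition orbit_Q_seq :: "nat \<Rightarrow> nat \<Rightarrow> clan_symbol list \<Rightarrow> complex mat set set" where
  "orbit_Q_seq p q c =
     (let n = p + q; \<sigma> = (SOME \<sigma>. admissible p q c \<sigma>);
          F = flag n (map (clan_vec n c \<sigma>) [0..<n])
      in {X \<in> lcosets\<^bsub>SL n\<^esub> (borel_SL n). \<exists>l\<in>levi_SL p q. flag_of_coset n X = act_flag l F})"

definition orbit_Q :: "nat \<Rightarrow> nat \<Rightarrow> clan_symbol list set \<Rightarrow> complex mat set set" where
  "orbit_Q p q = on_class (orbit_Q_seq p q)"

definition orbit_R :: "nat \<Rightarrow> nat \<Rightarrow> clan_symbol list set \<Rightarrow> complex mat set set" where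
  "orbit_R p q \<gamma> = {(inv\<^bsub>SL (p + q)\<^esub> g) <#\<^bsub>SL (p + q)\<^esub> levi_SL p q | g.
     g \<in> carrier (SL (p + q)) \<and> g <#\<^bsub>SL (p + q)\<^esub> borel_SL (p + q) \<in> orbit_Q p q \<gamma>}"

end

theory Submission
  imports Defs
begin

text \<open>
  Let \<open>\<theta>\<close> be the diagonal matrix with \<open>p\<close> entries \<open>1\<close> followed by \<open>q\<close> entries \<open>-1\<close>, so that \<open>L\<close> is
  the centralizer of \<open>\<theta>\<close> in \<open>SL\<close>. Up to conjugation by upper triangular matrices, the involution
  \<open>g\<^sup>-\<^sup>1 \<theta> g\<close> determines the \<open>L\<close>-orbit of the flag of \<open>g\<close>; for the flag \<open>\<langle>v\<^sub>1, \<dots>, v\<^sub>n\<rangle>\<close> of a clan it is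
  the signed permutation matrix that swaps matching positions and has the signs of the clan at its
  fixed points. Disjointness follows, since a signed permutation matrix can be
  recovered from its conjugacy class under triangular matrices.

  The plane of \<open>g\<^sup>-\<^sup>1 P\<close> is the \<open>1\<close>-eigenspace of \<open>g\<^sup>-\<^sup>1 \<theta> g\<close>. It lies in \<open>C\<^sub>I\<close> iff this involution is conjugate
  under triangular matrices to \<open>\<theta>\<^sub>I + N\<close>, where \<open>\<theta>\<^sub>I\<close> is diagonal with entries \<open>1\<close> at the positions of
  \<open>I\<close> and \<open>-1\<close> elsewhere, and \<open>N\<close> maps the complementary coordinates to those of \<open>I\<close>. Gaussian elimination turns
  \<open>N\<close> into a partial permutation matrix; its entries above the diagonal can be removed, and those below it
  are the matching pairs \<open>(-, +)\<close> of a clan of the sect.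
\<close>

subsection \<open>Coordinate subspaces, sign matrices and triangular matrices\<close>

definition coord_space :: "nat \<Rightarrow> nat set \<Rightarrow> 'a::zero vec set" where
  "coord_space n S = {x \<in> carrier_vec n. \<forall>i<n. i \<notin> S \<longrightarrow> x $ i = 0}"

text \<open>For \<open>S = {..<p}\<close> this is \<theta>, for the index set of \<open>I\<close> it
  is the diagonal part \<theta>_I of the normal form.\<close>

definition sign_mat :: "nat \<Rightarrow> nat set \<Rightarrow> 'a::ring_1 mat" where
  "sign_mat n S = mat n n (\<lambda>(i, j). if i = j then (if i \<in> S then 1 else - 1) else 0)"

text \<open>A nonzero determinant instead of determinant 1 spares the eliminations any
  normalisation. Over the complex numbers a scalar factor leads back to \<open>borel_SL\<close>, and
  it changes neither flags nor images of coordinate subspaces.\<close>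

definition borel_GL :: "nat \<Rightarrow> 'a::comm_ring_1 mat set" where
  "borel_GL n = {T \<in> carrier_mat n n. upper_triangular T \<and> det T \<noteq> 0}"

lemma coord_space_carrier: "x \<in> coord_space n S \<Longrightarrow> x \<in> carrier_vec n"
  by (simp add: coord_space_def)

lemma unit_vec_in_coord_space: "j \<in> S \<Longrightarrow> unit_vec n j \<in> coord_space n S"
  by (auto simp: coord_space_def unit_vec_def)

lemma sign_mat_carrier [simp]: "sign_mat n S \<in> carrier_mat n n"
  by (simp add: sign_mat_def)

lemma obtain_inverse_mat:
  fixes A :: "'a::field mat"
  assumes "A \<in> carrier_mat n n" "det A \<noteq> 0"
  obtains B where "B \<in> carrier_mat n n" "A * B = 1\<^sub>m n" "B * A = 1\<^sub>m n" "det B \<noteq> 0"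
proof -
  from det_non_zero_imp_unit[OF assms, of undefined] obtain B
    where B: "B \<in> carrier_mat n n" "A * B = 1\<^sub>m n" "B * A = 1\<^sub>m n"
    unfolding Units_def ring_mat_def by auto
  from det_mult[OF B(1) assms(1)] B(3) have "det B \<noteq> 0" by auto
  with B that show ?thesis by blast
qed

lemma mult_mat_entry:
  assumes "A \<in> carrier_mat n n" "B \<in> carrier_mat n n" "i < n" "j < n"
  shows "(A * B) $$ (i, j) = (\<Sum>k<n. A $$ (i, k) * B $$ (k, j))"
  using assms by (auto simp: times_mat_def scalar_prod_def atLeast0LessThan)

lemma mult_vec_entry:
  assumes "A \<in> carrier_mat n n" "x \<in> carrier_vec n" "i < n"
  shows "(A *\<^sub>v x) $ i = (\<Sum>k<n. A $$ (i, k) * x $ k)"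
  using assms by (auto simp: mult_mat_vec_def scalar_prod_def atLeast0LessThan)

lemma sign_mat_mult_entry:
  assumes "A \<in> carrier_mat n n" "i < n" "j < n"
  shows "(sign_mat n S * A) $$ (i, j) = (if i \<in> S then A $$ (i, j) else - A $$ (i, j))"
    and "(A * sign_mat n S) $$ (i, j) = (if j \<in> S then A $$ (i, j) else - A $$ (i, j))"
  unfolding mult_mat_entry[OF sign_mat_carrier assms] mult_mat_entry[OF assms(1) sign_mat_carrier assms(2,3)]
  using assms(2,3)
  by (simp_all add: sign_mat_def if_distrib[of "\<lambda>x. x * _"] if_distrib[of "\<lambda>x. _ * x"] cong: if_cong)

lemma sign_mat_mult_vec_entry:
  assumes "x \<in> carrier_vec n" "i < n"
  shows "(sign_mat n S *\<^sub>v x) $ i = (if i \<in> S then x $ i else - x $ i)"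
  unfolding mult_vec_entry[OF sign_mat_carrier assms]
  using assms(2) by (simp add: sign_mat_def if_distrib[of "\<lambda>x. x * _"] cong: if_cong)

text \<open>Coordinates outside \<open>S\<close> are negated, and \<open>- a = a\<close> forces
  \<open>a = 0\<close> over the complex numbers. Planes are read off from involutions through this
  eigenspace.\<close>

lemma sign_mat_fix_iff:
  fixes x :: "complex vec"
  assumes "x \<in> carrier_vec n"
  shows "sign_mat n S *\<^sub>v x = x \<longleftrightarrow> x \<in> coord_space n S"
proof -
  have "sign_mat n S *\<^sub>v x \<in> carrier_vec n"
    using assms by (intro mult_mat_vec_carrier[OF sign_mat_carrier])
  then have "sign_mat n S *\<^sub>v x = x \<longleftrightarrow> (\<forall>i<n. (sign_mat n S *\<^sub>v x) $ i = x $ i)"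
    using assms by (metis carrier_vecD eq_vecI)
  also have "\<dots> \<longleftrightarrow> x \<in> coord_space n S"
    using assms by (auto simp: sign_mat_mult_vec_entry coord_space_def eq_neg_iff_add_eq_0 split: if_splits)
  finally show ?thesis .
qed

lemma borel_GLD:
  assumes "T \<in> borel_GL n"
  shows "T \<in> carrier_mat n n" "upper_triangular T" "det T \<noteq> 0"
    and "\<And>i j. j < i \<Longrightarrow> i < n \<Longrightarrow> T $$ (i, j) = 0"
  using assms by (auto simp: borel_GL_def)

lemma borel_GL_diag:
  fixes T :: "'a::idom mat"
  assumes "T \<in> borel_GL n" "i < n"
  shows "T $$ (i, i) \<noteq> 0"
proof -
  have "0 \<notin> set (diag_mat T)"
    using borel_GLD[OF assms(1)] upper_triangular_imp_det_eq_0_iff by blast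
  then show ?thesis
    using assms borel_GLD(1)[OF assms(1)] by (auto simp: diag_mat_def)
qed

lemma borel_GLI:
  fixes T :: "'a::idom mat"
  assumes "T \<in> carrier_mat n n" "\<And>i j. j < i \<Longrightarrow> i < n \<Longrightarrow> T $$ (i, j) = 0"
    "\<And>i. i < n \<Longrightarrow> T $$ (i, i) \<noteq> 0"
  shows "T \<in> borel_GL n"
proof -
  have ut: "upper_triangular T"
    using assms(1,2) by auto
  moreover have "det T \<noteq> 0"
    unfolding upper_triangular_imp_det_eq_0_iff[OF assms(1) ut]
    using assms(1,3) by (auto simp: diag_mat_def)
  ultimately show ?thesis
    using assms(1) by (simp add: borel_GL_def)
qed

lemma borel_GL_one: "1\<^sub>m n \<in> (borel_GL n :: 'a::idom mat set)"
  by (rule borel_GLI) auto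

lemma borel_GL_mult:
  fixes S T :: "'a::idom mat"
  assumes "S \<in> borel_GL n" "T \<in> borel_GL n"
  shows "S * T \<in> borel_GL n"
proof -
  note S = borel_GLD[OF assms(1)] and T = borel_GLD[OF assms(2)]
  have "(S * T) $$ (i, j) = 0" if "j < i" "i < n" for i j
  proof -
    have "S $$ (i, k) * T $$ (k, j) = 0" if "k < n" for k
      using S(4)[of k i] T(4)[of j k] \<open>j < i\<close> \<open>i < n\<close> that by (cases "k < i") auto
    then show ?thesis
      using that by (simp add: mult_mat_entry[OF S(1) T(1)] sum.neutral del: mult_eq_0_iff)
  qed
  moreover have "det (S * T) \<noteq> 0"
    using det_mult[OF S(1) T(1)] S(3) T(3) by simp
  ultimately show ?thesis
    using S(1) T(1) by (auto simp: borel_GL_def)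
qed

text \<open>Entry \<open>(i, j)\<close> of \<open>S * T = 1\<close> below the diagonal, by induction
  on \<open>j\<close>: the terms with \<open>k < j\<close> vanish by induction and those with
  \<open>k > j\<close> because \<open>T\<close> is triangular. What remains is
  \<open>S $$ (i, j)\<close> times a nonzero diagonal entry of \<open>T\<close>.\<close>

lemma borel_GL_inverse:
  fixes T :: "'a::field mat"
  assumes "T \<in> borel_GL n"
  obtains S where "S \<in> borel_GL n" "T * S = 1\<^sub>m n" "S * T = 1\<^sub>m n"
proof -
  note T = borel_GLD[OF assms]
  obtain S where S: "S \<in> carrier_mat n n" "T * S = 1\<^sub>m n" "S * T = 1\<^sub>m n" "det S \<noteq> 0"
    using obtain_inverse_mat[OF T(1,3)] .
  have "S $$ (i, j) = 0" if "j < i" "i < n" for i j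
    using that
  proof (induction j rule: less_induct)
    case (less j)
    have "S $$ (i, k) * T $$ (k, j) = 0" if "k < n" "k \<noteq> j" for k
      using less T(4)[of j k] that by (cases "k < j") auto
    then have "(S * T) $$ (i, j) = S $$ (i, j) * T $$ (j, j)"
      using less.prems sum.mono_neutral_right[of "{..<n}" "{j}" "\<lambda>k. S $$ (i, k) * T $$ (k, j)"]
      by (auto simp: mult_mat_entry[OF S(1) T(1)])
    then show ?case
      using S(3) less.prems borel_GL_diag[OF assms, of j] by auto
  qed
  then have "S \<in> borel_GL n"
    using S(1,4) by (auto simp: borel_GL_def)
  with S that show ?thesis by blast
qed

lemma borel_GL_smult:
  fixes T :: "'a::idom mat"
  assumes "T \<in> borel_GL n" "c \<noteq> 0"
  shows "c \<cdot>\<^sub>m T \<in> borel_GL n"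
  using assms borel_GL_diag[OF assms(1)] borel_GLD[OF assms(1)] by (intro borel_GLI) auto

text \<open>Since \<open>det (c A) = c ^ n * det A\<close>, such a \<open>c\<close> scales an
  invertible matrix to determinant 1.\<close>

lemma exists_root_inverse:
  fixes d :: complex
  assumes "d \<noteq> 0" "n > 0"
  obtains c where "c \<noteq> 0" "c ^ n * d = 1"
proof -
  obtain r where r: "r ^ n = inverse d"
    using card_nth_roots[of "inverse d" n] assms by (cases "{z. z ^ n = inverse d} = {}") auto
  have "r \<noteq> 0"
    using r assms by (auto simp: power_0_left)
  with r assms that show ?thesis by simp
qed

lemma image_coord_space_smult:
  fixes A :: "'a::field mat"
  assumes "A \<in> carrier_mat n n" "c \<noteq> 0"
  shows "(\<lambda>v. (c \<cdot>\<^sub>m A) *\<^sub>v v) ` coord_space n S = (\<lambda>v. A *\<^sub>v v) ` coord_space n S"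
proof -
  have *: "(\<lambda>v. (d \<cdot>\<^sub>m B) *\<^sub>v v) ` coord_space n S \<subseteq> (\<lambda>v. B *\<^sub>v v) ` coord_space n S"
    if "B \<in> carrier_mat n n" for B :: "'a mat" and d
  proof
    fix w assume "w \<in> (\<lambda>v. (d \<cdot>\<^sub>m B) *\<^sub>v v) ` coord_space n S"
    then obtain x where x: "x \<in> coord_space n S" "w = (d \<cdot>\<^sub>m B) *\<^sub>v x" by auto
    have "w = B *\<^sub>v (d \<cdot>\<^sub>v x)"
      using that coord_space_carrier[OF x(1)] unfolding x(2)
      by (intro eq_vecI) (auto simp: scalar_prod_def sum_distrib_left mult.assoc mult.left_commute)
    moreover have "d \<cdot>\<^sub>v x \<in> coord_space n S"
      using x(1) by (auto simp: coord_space_def)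
    ultimately show "w \<in> (\<lambda>v. B *\<^sub>v v) ` coord_space n S" by blast
  qed
  have "inverse c \<cdot>\<^sub>m (c \<cdot>\<^sub>m A) = A"
    using assms by (intro eq_matI) auto
  then show ?thesis
    using *[of "c \<cdot>\<^sub>m A" "inverse c"] *[of A c] assms by auto
qed

section \<open>Spans and flags as images of coordinate subspaces\<close>

lemma coord_space_zero: "0\<^sub>v n \<in> (coord_space n S :: 'a::semiring_1 vec set)"
  by (simp add: coord_space_def)

lemma image_coord_space_mult:
  assumes "A \<in> carrier_mat n n" "B \<in> carrier_mat n n"
  shows "(\<lambda>v. (A * B) *\<^sub>v v) ` coord_space n S = (\<lambda>v. A *\<^sub>v v) ` (\<lambda>v. B *\<^sub>v v) ` coord_space n S"
  unfolding image_image
  by (rule image_cong[OF refl]) (use assms coord_space_carrier in \<open>auto intro!: assoc_mult_mat_vec\<close>)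

lemma image_coord_space_one: "(\<lambda>v. 1\<^sub>m n *\<^sub>v v) ` coord_space n S = (coord_space n S :: 'a::semiring_1 vec set)"
  using coord_space_carrier by (force simp: image_iff)

text \<open>Replaces spans in the abstract module by images of coordinate subspaces, on which all
  later arguments run. One inclusion splits off a coordinate of \<open>x\<close> at a time, by
  induction on \<open>S\<close>; the other holds because the image is a submodule that contains the
  columns.\<close>

lemma vspan_cols:
  assumes A: "A \<in> carrier_mat n n" and S: "S \<subseteq> {..<n}"
  shows "vspan n (col A ` S) = (\<lambda>v. A *\<^sub>v v) ` coord_space n S"
proof -
  interpret V: vec_space "TYPE(complex)" n .
  have cols: "col A ` T \<subseteq> carrier_vec n" for T
    using A by auto
  have fin: "finite S"
    using S finite_subset by blast
  have coord: "A *\<^sub>v x \<in> V.span (col A ` S)" if "x \<in> coord_space n S" for x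
    using fin that S
  proof (induction S arbitrary: x)
    case empty
    then have "x = 0\<^sub>v n"
      by (auto simp: coord_space_def)
    moreover have "A *\<^sub>v 0\<^sub>v n = 0\<^sub>v n"
      using A by (intro eq_vecI) auto
    ultimately show ?case
      using V.span_zero by simp
  next
    case (insert j S)
    define y where "y = x - x $ j \<cdot>\<^sub>v unit_vec n j"
    have x: "x \<in> carrier_vec n" and j: "j < n"
      using insert coord_space_carrier by auto
    have "y \<in> coord_space n S"
      using insert by (auto simp: coord_space_def y_def)
    then have 1: "A *\<^sub>v y \<in> V.span (col A ` S)"
      using insert by auto
    have "x = y + x $ j \<cdot>\<^sub>v unit_vec n j"
      using x by (auto simp: y_def)
    then have "A *\<^sub>v x = A *\<^sub>v y + x $ j \<cdot>\<^sub>v (A *\<^sub>v unit_vec n j)"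
      using A x j by (metis (no_types, lifting) coord_space_carrier \<open>y \<in> coord_space n S\<close> mult_add_distrib_mat_vec mult_mat_vec
          smult_carrier_vec unit_vec_carrier)
    also have "A *\<^sub>v unit_vec n j = col A j"
      using A j by (auto simp: mult_mat_vec_def intro!: eq_vecI)
    finally have eq: "A *\<^sub>v x = A *\<^sub>v y + x $ j \<cdot>\<^sub>v col A j" .
    have "A *\<^sub>v y \<in> V.span (col A ` insert j S)"
      using 1 V.span_is_monotone[of "col A ` S" "col A ` insert j S"] by auto
    moreover have "x $ j \<cdot>\<^sub>v col A j \<in> V.span (col A ` insert j S)"
      by (intro V.smult_in_span cols V.span_mem) auto
    ultimately show ?case
      unfolding eq by (intro V.span_add1 cols)
  qed
  show ?thesis
  proof
    show "vspan n (col A ` S) \<subseteq> (\<lambda>v. A *\<^sub>v v) ` coord_space n S"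
    proof (rule V.span_is_subset)
      show "col A ` S \<subseteq> (\<lambda>v. A *\<^sub>v v) ` coord_space n S"
      proof
        fix w assume "w \<in> col A ` S"
        then obtain j where j: "j \<in> S" "w = col A j" by auto
        then have "j < n" using S by auto
        then have "w = A *\<^sub>v unit_vec n j"
          using A j by (auto simp: mult_mat_vec_def intro!: eq_vecI)
        then show "w \<in> (\<lambda>v. A *\<^sub>v v) ` coord_space n S"
          using unit_vec_in_coord_space[OF j(1)] by blast
      qed
      show "submodule class_ring ((\<lambda>v. A *\<^sub>v v) ` coord_space n S) V.V"
      proof (rule submodule.intro)
        show "\<zero>\<^bsub>V.V\<^esub> \<in> (\<lambda>v. A *\<^sub>v v) ` coord_space n S"
          using A coord_space_zero[of n S] by (auto simp: module_vec_simps intro!: image_eqI[of _ _ "0\<^sub>v n"])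
      next
        fix v w assume "v \<in> (\<lambda>v. A *\<^sub>v v) ` coord_space n S" "w \<in> (\<lambda>v. A *\<^sub>v v) ` coord_space n S"
        then obtain x y where "x \<in> coord_space n S" "y \<in> coord_space n S" "v = A *\<^sub>v x" "w = A *\<^sub>v y" by auto
        then show "v \<oplus>\<^bsub>V.V\<^esub> w \<in> (\<lambda>v. A *\<^sub>v v) ` coord_space n S"
          using A by (intro image_eqI[of _ _ "x + y"])
            (auto simp: module_vec_simps mult_add_distrib_mat_vec coord_space_def)
      next
        fix c v assume "v \<in> (\<lambda>v. A *\<^sub>v v) ` coord_space n S"
        then obtain x where "x \<in> coord_space n S" "v = A *\<^sub>v x" by auto
        then show "c \<odot>\<^bsub>V.V\<^esub> v \<in> (\<lambda>v. A *\<^sub>v v) ` coord_space n S"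
          using A by (intro image_eqI[of _ _ "c \<cdot>\<^sub>v x"])
            (auto simp: module_vec_simps mult_mat_vec coord_space_def)
      qed (use A in \<open>auto intro: V.module_axioms coord_space_carrier mult_mat_vec_carrier\<close>)
    qed
    show "(\<lambda>v. A *\<^sub>v v) ` coord_space n S \<subseteq> vspan n (col A ` S)"
      using coord by auto
  qed
qed

lemma vspan_take_cols:
  assumes "A \<in> carrier_mat n n" "i \<le> n"
  shows "vspan n (set (take i (cols A))) = (\<lambda>v. A *\<^sub>v v) ` coord_space n {..<i}"
proof -
  have "set (take i (cols A)) = col A ` {..<i}"
    using assms by (auto simp: cols_def take_map min_def atLeast0LessThan)
  then show ?thesis
    using vspan_cols[OF assms(1), of "{..<i}"] assms(2) by auto
qed

lemma vspan_unit_vecs: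
  assumes "J \<subseteq> {..<n}"
  shows "vspan n (unit_vec n ` J) = coord_space n J"
proof -
  have "unit_vec n ` J = col (1\<^sub>m n) ` J"
    using assms by (intro image_cong) auto
  moreover have "(\<lambda>v. 1\<^sub>m n *\<^sub>v v) ` coord_space n J = (coord_space n J :: complex vec set)"
    by (rule image_coord_space_one)
  ultimately show ?thesis
    using vspan_cols[OF one_carrier_mat assms] by metis
qed

lemma flag_cols:
  assumes "A \<in> carrier_mat n n"
  shows "flag n (cols A) = map (\<lambda>i. (\<lambda>v. A *\<^sub>v v) ` coord_space n {..<i}) [1..<Suc n]"
  unfolding flag_def using assms by (intro map_cong[OF refl] vspan_take_cols) auto

lemma act_flag_cols:
  assumes "l \<in> carrier_mat n n" "A \<in> carrier_mat n n"
  shows "act_flag l (flag n (cols A)) = flag n (cols (l * A))"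
  using assms
  by (auto simp: act_flag_def act_space_def flag_cols[of _ n] image_coord_space_mult)

text \<open>A triangular matrix sends each unit vector into the span of the unit vectors up to its
  index, which gives one inclusion; the inverse is triangular too and gives the other.\<close>

lemma borel_GL_image_coord_space:
  fixes T :: "'a::field mat"
  assumes "T \<in> borel_GL n"
  shows "(\<lambda>v. T *\<^sub>v v) ` coord_space n {..<i} = coord_space n {..<i}"
proof -
  have sub: "(\<lambda>v. S *\<^sub>v v) ` coord_space n {..<i} \<subseteq> coord_space n {..<i}" if "S \<in> borel_GL n" for S :: "'a mat"
  proof
    fix w assume "w \<in> (\<lambda>v. S *\<^sub>v v) ` coord_space n {..<i}"
    then obtain x where x: "x \<in> coord_space n {..<i}" "w = S *\<^sub>v x" by auto
    note S = borel_GLD[OF that]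
    have "w $ j = 0" if "j < n" "\<not> j < i" for j
    proof -
      have "S $$ (j, k) * x $ k = 0" if "k < n" for k
        using S(4)[of k j] x(1) \<open>j < n\<close> \<open>\<not> j < i\<close> that by (cases "k < j") (auto simp: coord_space_def)
      then show ?thesis
        using x \<open>j < n\<close> coord_space_carrier[OF x(1)]
        by (simp add: mult_vec_entry[OF S(1)] sum.neutral del: mult_eq_0_iff)
    qed
    then show "w \<in> coord_space n {..<i}"
      using x S(1) by (auto simp: coord_space_def)
  qed
  obtain S where S: "S \<in> borel_GL n" "T * S = 1\<^sub>m n"
    using borel_GL_inverse[OF assms] by metis
  have "coord_space n {..<i} = (\<lambda>v. T *\<^sub>v v) ` (\<lambda>v. S *\<^sub>v v) ` coord_space n {..<i}"
    unfolding image_coord_space_mult[OF borel_GLD(1)[OF assms] borel_GLD(1)[OF S(1)], symmetric] S(2)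
    by (rule image_coord_space_one[symmetric])
  then show ?thesis
    using sub[OF S(1)] sub[OF assms] by blast
qed

lemma flag_cols_mult_borel:
  assumes "A \<in> carrier_mat n n" "T \<in> borel_GL n"
  shows "flag n (cols (A * T)) = flag n (cols A)"
  using borel_GLD(1)[OF assms(2)] assms
  by (auto simp: flag_cols image_coord_space_mult borel_GL_image_coord_space)

text \<open>Take \<open>T\<close> to be the inverse of \<open>B\<close> times \<open>A\<close>. Its
  column \<open>j\<close> expresses column \<open>j\<close> of \<open>A\<close> in the columns of
  \<open>B\<close>, and equality of the flags allows only the first \<open>j + 1\<close> of
  these.\<close>

lemma flag_cols_eqD:
  assumes A: "A \<in> carrier_mat n n" "det A \<noteq> 0" and B: "B \<in> carrier_mat n n" "det B \<noteq> 0"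
    and eq: "flag n (cols A) = flag n (cols B)"
  obtains T where "T \<in> borel_GL n" "A = B * T"
proof -
  obtain B' where B': "B' \<in> carrier_mat n n" "B * B' = 1\<^sub>m n" "B' * B = 1\<^sub>m n" "det B' \<noteq> 0"
    using obtain_inverse_mat[OF B] .
  define T where "T = B' * A"
  have T: "T \<in> carrier_mat n n" "det T \<noteq> 0"
    using A B' by (auto simp: T_def det_mult[OF B'(1) A(1)])
  have "B * T = (B * B') * A"
    unfolding T_def using A B B' by (intro assoc_mult_mat[symmetric])
  then have BT: "A = B * T"
    using B' A by simp
  have "T $$ (i, j) = 0" if "j < i" "i < n" for i j
  proof -
    \<comment> \<open>Flags list their subspaces from dimension 1 on, so column \<open>j\<close> is
      controlled by dimension \<open>Suc j\<close>.\<close>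
    have j: "Suc j \<in> set [1..<Suc n]"
      using that by auto
    then have "(\<lambda>v. A *\<^sub>v v) ` coord_space n {..<Suc j} = (\<lambda>v. B *\<^sub>v v) ` coord_space n {..<Suc j}"
      using eq unfolding flag_cols[OF A(1)] flag_cols[OF B(1)] by (metis (no_types, lifting) map_eq_conv)
    then have "A *\<^sub>v unit_vec n j \<in> (\<lambda>v. B *\<^sub>v v) ` coord_space n {..<Suc j}"
      using unit_vec_in_coord_space[of j "{..<Suc j}" n] by auto
    then obtain x where x: "x \<in> coord_space n {..<Suc j}" "A *\<^sub>v unit_vec n j = B *\<^sub>v x"
      by auto
    have "T *\<^sub>v unit_vec n j = B' *\<^sub>v (B *\<^sub>v x)"
      using x(2) A(1) B'(1) by (simp add: T_def assoc_mult_mat_vec[of _ n n _ n])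
    also have "\<dots> = (B' * B) *\<^sub>v x"
      using B'(1) B(1) coord_space_carrier[OF x(1)] by (intro assoc_mult_mat_vec[symmetric])
    also have "\<dots> = x"
      using B' coord_space_carrier[OF x(1)] by simp
    finally have "x = T *\<^sub>v unit_vec n j" by simp
    moreover have "(T *\<^sub>v unit_vec n j) $ i = T $$ (i, j)"
      using T that by (auto simp: mult_mat_vec_def)
    ultimately show ?thesis
      using x(1) that by (auto simp: coord_space_def)
  qed
  then have "T \<in> borel_GL n"
    using T by (auto simp: borel_GL_def)
  with BT that show ?thesis by blast
qed

subsection \<open>The groups and their cosets\<close>

text \<open>Both products have entries \<open>A $$ (i, j)\<close> up to sign, and the signs differ
  exactly when one of \<open>i\<close>, \<open>j\<close> lies in \<open>S\<close> and the other does
  not. Commuting with a sign matrix is thus block diagonality.\<close>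

lemma sign_mat_commute_iff:
  fixes A :: "complex mat"
  assumes "A \<in> carrier_mat n n"
  shows "sign_mat n S * A = A * sign_mat n S \<longleftrightarrow>
    (\<forall>i<n. \<forall>j<n. (i \<in> S) \<noteq> (j \<in> S) \<longrightarrow> A $$ (i, j) = 0)"
proof -
  have "sign_mat n S * A \<in> carrier_mat n n" "A * sign_mat n S \<in> carrier_mat n n"
    using mult_carrier_mat[OF sign_mat_carrier assms] mult_carrier_mat[OF assms sign_mat_carrier] by auto
  then have "sign_mat n S * A = A * sign_mat n S \<longleftrightarrow>
      (\<forall>i<n. \<forall>j<n. (sign_mat n S * A) $$ (i, j) = (A * sign_mat n S) $$ (i, j))"
    by (metis carrier_matD eq_matI)
  then show ?thesis
    using assms by (auto simp: sign_mat_mult_entry eq_neg_iff_add_eq_0 neg_eq_iff_add_eq_0 split: if_splits)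
qed

text \<open>The last clause keeps track of the entries of \<open>h\<close>, so that the Levi case
  can conclude that \<open>h\<close> is zero.\<close>

lemma four_block_of_entries:
  assumes "A \<in> carrier_mat (p + q) (p + q)" "\<And>i j. p \<le> i \<Longrightarrow> i < p + q \<Longrightarrow> j < p \<Longrightarrow> A $$ (i, j) = 0"
  obtains x h y where "x \<in> carrier_mat p p" "h \<in> carrier_mat p q" "y \<in> carrier_mat q q"
    "A = four_block_mat x h (0\<^sub>m q p) y" "\<And>i j. i < p \<Longrightarrow> j < q \<Longrightarrow> h $$ (i, j) = A $$ (i, p + j)"
proof
  define x where "x = mat p p (\<lambda>(i, j). A $$ (i, j))"
  define h where "h = mat p q (\<lambda>(i, j). A $$ (i, p + j))"
  define y where "y = mat q q (\<lambda>(i, j). A $$ (p + i, p + j))"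
  show "A = four_block_mat x h (0\<^sub>m q p) y"
    using assms by (intro eq_matI) (auto simp: x_def h_def y_def)
  show "x \<in> carrier_mat p p" "h \<in> carrier_mat p q" "y \<in> carrier_mat q q"
    by (auto simp: x_def h_def y_def)
  show "\<And>i j. i < p \<Longrightarrow> j < q \<Longrightarrow> h $$ (i, j) = A $$ (i, p + j)"
    by (simp add: h_def)
qed

lemma parabolic_SL_iff:
  "A \<in> parabolic_SL p q \<longleftrightarrow> A \<in> carrier_mat (p + q) (p + q) \<and> det A = 1 \<and>
     (\<forall>i j. p \<le> i \<longrightarrow> i < p + q \<longrightarrow> j < p \<longrightarrow> A $$ (i, j) = 0)"
proof
  assume "A \<in> parabolic_SL p q"
  then obtain x h y where *: "A = four_block_mat x h (0\<^sub>m q p) y" "x \<in> carrier_mat p p"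
    "y \<in> carrier_mat q q" "h \<in> carrier_mat p q" "det x * det y = 1"
    unfolding parabolic_SL_def by auto
  then show "A \<in> carrier_mat (p + q) (p + q) \<and> det A = 1 \<and>
     (\<forall>i j. p \<le> i \<longrightarrow> i < p + q \<longrightarrow> j < p \<longrightarrow> A $$ (i, j) = 0)"
    by (auto simp: det_four_block_mat_lower_left_zero[of _ p _ q])
next
  assume *: "A \<in> carrier_mat (p + q) (p + q) \<and> det A = 1 \<and>
     (\<forall>i j. p \<le> i \<longrightarrow> i < p + q \<longrightarrow> j < p \<longrightarrow> A $$ (i, j) = 0)"
  then obtain x h y where "x \<in> carrier_mat p p" "h \<in> carrier_mat p q" "y \<in> carrier_mat q q"
    "A = four_block_mat x h (0\<^sub>m q p) y"
    using four_block_of_entries[of A p q] by metis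
  with * show "A \<in> parabolic_SL p q"
    unfolding parabolic_SL_def using det_four_block_mat_lower_left_zero[of x p h q _ y] by auto
qed

text \<open>Presents L as the centralizer of \<theta> in SL, which turns statements about L-orbits
  into statements about conjugates of \<theta>.\<close>

lemma levi_SL_iff:
  "A \<in> levi_SL p q \<longleftrightarrow> A \<in> carrier_mat (p + q) (p + q) \<and> det A = 1 \<and>
     sign_mat (p + q) {..<p} * A = A * sign_mat (p + q) {..<p}"
proof
  assume "A \<in> levi_SL p q"
  then obtain x y where *: "A = four_block_mat x (0\<^sub>m p q) (0\<^sub>m q p) y" "x \<in> carrier_mat p p"
    "y \<in> carrier_mat q q" "det x * det y = 1"
    unfolding levi_SL_def by auto
  then have A: "A \<in> carrier_mat (p + q) (p + q)" by simp
  with * show "A \<in> carrier_mat (p + q) (p + q) \<and> det A = 1 \<and>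
     sign_mat (p + q) {..<p} * A = A * sign_mat (p + q) {..<p}"
    unfolding sign_mat_commute_iff[OF A] by (auto simp: det_four_block_mat_lower_left_zero[of _ p _ q])
next
  assume *: "A \<in> carrier_mat (p + q) (p + q) \<and> det A = 1 \<and>
     sign_mat (p + q) {..<p} * A = A * sign_mat (p + q) {..<p}"
  then have 0: "A $$ (i, j) = 0" if "i < p + q" "j < p + q" "(i < p) \<noteq> (j < p)" for i j
    using sign_mat_commute_iff[of A "p + q" "{..<p}"] that by auto
  obtain x h y where xy: "x \<in> carrier_mat p p" "h \<in> carrier_mat p q" "y \<in> carrier_mat q q"
    "A = four_block_mat x h (0\<^sub>m q p) y" "\<And>i j. i < p \<Longrightarrow> j < q \<Longrightarrow> h $$ (i, j) = A $$ (i, p + j)"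
    using four_block_of_entries[of A p q] 0 * by (metis less_add_same_cancel1 linorder_not_less trans_less_add1)
  have "h $$ (i, j) = 0" if "i < p" "j < q" for i j
    using xy(5)[OF that] 0[of i "p + j"] that by simp
  then have "h = 0\<^sub>m p q"
    using xy(2) by (intro eq_matI) auto
  with * xy show "A \<in> levi_SL p q"
    unfolding levi_SL_def using det_four_block_mat_lower_left_zero[of x p h q _ y] by auto
qed

lemma carrier_SL_iff: "A \<in> carrier (SL n) \<longleftrightarrow> A \<in> carrier_mat n n \<and> det A = 1"
  by (simp add: SL_def)

lemma l_coset_SL: "g <#\<^bsub>SL n\<^esub> H = (\<lambda>h. g * h) ` H"
  by (auto simp: l_coset_def SL_def)

lemma group_SL: "group (SL n)"
proof (rule groupI)
  fix A assume "A \<in> carrier (SL n)"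
  then have A: "A \<in> carrier_mat n n" "det A = 1"
    by (auto simp: carrier_SL_iff)
  then obtain B where B: "B \<in> carrier_mat n n" "B * A = 1\<^sub>m n"
    using obtain_inverse_mat[of A n] by (metis zero_neq_one)
  then have "det B = 1"
    using det_mult[OF B(1) A(1)] A by simp
  with B show "\<exists>B\<in>carrier (SL n). B \<otimes>\<^bsub>SL n\<^esub> A = \<one>\<^bsub>SL n\<^esub>"
    by (auto simp: SL_def)
qed (auto simp: SL_def det_mult[of _ n])

lemma inv_SL:
  assumes "g \<in> carrier (SL n)"
  shows "inv\<^bsub>SL n\<^esub> g \<in> carrier (SL n)" "inv\<^bsub>SL n\<^esub> g * g = 1\<^sub>m n" "g * inv\<^bsub>SL n\<^esub> g = 1\<^sub>m n"
    "inv\<^bsub>SL n\<^esub> (inv\<^bsub>SL n\<^esub> g) = g"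
proof -
  interpret group "SL n" by (rule group_SL)
  show "inv\<^bsub>SL n\<^esub> g \<in> carrier (SL n)" "inv\<^bsub>SL n\<^esub> (inv\<^bsub>SL n\<^esub> g) = g"
    using assms by auto
  show "inv\<^bsub>SL n\<^esub> g * g = 1\<^sub>m n" "g * inv\<^bsub>SL n\<^esub> g = 1\<^sub>m n"
    using l_inv[OF assms] r_inv[OF assms] by (auto simp: SL_def)
qed

lemma parabolic_SL_mult:
  assumes "A \<in> parabolic_SL p q" "B \<in> parabolic_SL p q"
  shows "A * B \<in> parabolic_SL p q"
proof -
  have A: "A \<in> carrier_mat (p + q) (p + q)" and B: "B \<in> carrier_mat (p + q) (p + q)"
    using assms by (auto simp: parabolic_SL_iff)
  have "A $$ (i, k) * B $$ (k, j) = 0" if "p \<le> i" "i < p + q" "j < p" "k < p + q" for i j k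
    using assms that by (cases "k < p") (auto simp: parabolic_SL_iff)
  then show ?thesis
    using assms A B
    by (auto simp: parabolic_SL_iff det_mult[OF A B] mult_mat_entry[OF A B] sum.neutral
        simp del: mult_eq_0_iff index_mult_mat(1))
qed

lemma levi_SL_subset_parabolic: "levi_SL p q \<subseteq> parabolic_SL p q"
  by (auto simp: levi_SL_iff parabolic_SL_iff sign_mat_commute_iff)

lemma commute_inverse_mat:
  fixes T :: "'a::comm_ring_1 mat"
  assumes "T \<in> carrier_mat n n" "A \<in> carrier_mat n n" "B \<in> carrier_mat n n"
    and "T * A = A * T" "A * B = 1\<^sub>m n" "B * A = 1\<^sub>m n"
  shows "T * B = B * T"
proof -
  have "T * B = (B * A) * (T * B)"
    unfolding assms(6) using assms(1-3) by simp
  also have "\<dots> = B * ((A * T) * B)"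
    using assms(1-3) by (simp add: assoc_mult_mat[of _ n n _ n _ n])
  also have "\<dots> = (B * T) * (A * B)"
    unfolding assms(4)[symmetric] using assms(1-3) by (simp add: assoc_mult_mat[of _ n n _ n _ n])
  also have "\<dots> = B * T"
    unfolding assms(5) using assms(1-3) by simp
  finally show ?thesis .
qed

lemma levi_SL_inv:
  assumes "A \<in> levi_SL p q"
  shows "inv\<^bsub>SL (p + q)\<^esub> A \<in> levi_SL p q"
proof -
  have A: "A \<in> carrier_mat (p + q) (p + q)" "A \<in> carrier (SL (p + q))"
    using assms by (auto simp: levi_SL_iff carrier_SL_iff)
  show ?thesis
    using assms inv_SL[OF A(2)] commute_inverse_mat[OF sign_mat_carrier A(1)]
    by (auto simp: levi_SL_iff carrier_SL_iff)
qed

section \<open>Cosets, their planes and flags, and the Schubert cell\<close>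

lemma on_class_eq:
  assumes "x \<in> X" "\<And>y. y \<in> X \<Longrightarrow> f y = f x"
  shows "on_class f X = f x"
proof -
  have "f ` X = {f x}"
    using assms(1) by (auto simp: image_iff intro: assms(2) bexI[of _ x])
  then show ?thesis
    by (simp add: on_class_def)
qed

lemma one_levi_SL: "1\<^sub>m (p + q) \<in> levi_SL p q"
  by (simp add: levi_SL_iff left_mult_one_mat[OF sign_mat_carrier] right_mult_one_mat[OF sign_mat_carrier])

lemma parabolic_coset_mult_levi:
  assumes "g \<in> carrier (SL (p + q))" "l \<in> levi_SL p q"
  shows "(g * l) <#\<^bsub>SL (p + q)\<^esub> parabolic_SL p q = g <#\<^bsub>SL (p + q)\<^esub> parabolic_SL p q"
proof -
  let ?n = "p + q"
  have g: "g \<in> carrier_mat ?n ?n"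
    using assms by (simp add: carrier_SL_iff)
  have l: "l \<in> carrier_mat ?n ?n" "l \<in> carrier (SL ?n)"
    using assms by (auto simp: levi_SL_iff carrier_SL_iff)
  define k where "k = inv\<^bsub>SL ?n\<^esub> l"
  have k: "k \<in> levi_SL p q" "l * k = 1\<^sub>m ?n"
    using levi_SL_inv[OF assms(2)] inv_SL[OF l(2)] by (auto simp: k_def)
  have P: "l * h \<in> parabolic_SL p q" "k * h \<in> parabolic_SL p q" "h \<in> carrier_mat ?n ?n"
    if "h \<in> parabolic_SL p q" for h
    using parabolic_SL_mult[OF _ that] that assms(2) k(1) levi_SL_subset_parabolic[of p q]
    by (auto simp: parabolic_SL_iff[of h])
  have kc: "k \<in> carrier_mat ?n ?n"
    using k(1) by (simp add: levi_SL_iff)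
  show ?thesis
    unfolding l_coset_SL
  proof (intro equalityI subsetI)
    fix m assume "m \<in> (\<lambda>h. g * l * h) ` parabolic_SL p q"
    then obtain h where h: "h \<in> parabolic_SL p q" "m = g * l * h" by auto
    then have "m = g * (l * h)"
      using g l P[OF h(1)] by (simp add: assoc_mult_mat[of _ ?n ?n _ ?n _ ?n])
    then show "m \<in> (\<lambda>h. g * h) ` parabolic_SL p q"
      using P(1)[OF h(1)] by blast
  next
    fix m assume "m \<in> (\<lambda>h. g * h) ` parabolic_SL p q"
    then obtain h where h: "h \<in> parabolic_SL p q" "m = g * h" by auto
    have "g * l * (k * h) = g * ((l * k) * h)"
      using g l kc P(3)[OF h(1)] by (simp add: assoc_mult_mat[of _ ?n ?n _ ?n _ ?n])
    then have "m = g * l * (k * h)"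
      using h k(2) P(3)[OF h(1)] by simp
    then show "m \<in> (\<lambda>h. g * l * h) ` parabolic_SL p q"
      using P(2)[OF h(1)] by blast
  qed
qed

lemma proj_LP_coset:
  assumes "g \<in> carrier (SL (p + q))"
  shows "proj_LP p q (g <#\<^bsub>SL (p + q)\<^esub> levi_SL p q) = g <#\<^bsub>SL (p + q)\<^esub> parabolic_SL p q"
  unfolding proj_LP_def
proof (rule on_class_eq)
  have "g \<in> carrier_mat (p + q) (p + q)"
    using assms by (simp add: carrier_SL_iff)
  then show "g \<in> g <#\<^bsub>SL (p + q)\<^esub> levi_SL p q"
    unfolding l_coset_SL by (intro image_eqI[OF _ one_levi_SL]) simp
  fix m assume "m \<in> g <#\<^bsub>SL (p + q)\<^esub> levi_SL p q"
  then obtain l where "l \<in> levi_SL p q" "m = g * l"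
    unfolding l_coset_SL by blast
  then show "m <#\<^bsub>SL (p + q)\<^esub> parabolic_SL p q = g <#\<^bsub>SL (p + q)\<^esub> parabolic_SL p q"
    using parabolic_coset_mult_levi[OF assms] by simp
qed

lemma parabolic_SL_image_coord_space:
  assumes "r \<in> parabolic_SL p q"
  shows "(\<lambda>v. r *\<^sub>v v) ` coord_space (p + q) {..<p} = coord_space (p + q) {..<p}"
proof -
  let ?n = "p + q" and ?W = "coord_space (p + q) {..<p} :: complex vec set"
  have sub: "(\<lambda>v. A *\<^sub>v v) ` ?W \<subseteq> ?W"
    if A: "A \<in> carrier_mat ?n ?n" "\<And>i j. p \<le> i \<Longrightarrow> i < ?n \<Longrightarrow> j < p \<Longrightarrow> A $$ (i, j) = 0" for A
  proof
    fix w assume "w \<in> (\<lambda>v. A *\<^sub>v v) ` ?W"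
    then obtain x where x: "x \<in> ?W" "w = A *\<^sub>v x" by auto
    have "A $$ (i, k) * x $ k = 0" if "i < ?n" "\<not> i < p" "k < ?n" for i k
      using A x(1) that by (cases "k < p") (auto simp: coord_space_def)
    then have "w $ i = 0" if "i < ?n" "\<not> i < p" for i
      using x that coord_space_carrier[OF x(1)]
      by (simp add: mult_vec_entry[OF A(1)] sum.neutral del: mult_eq_0_iff)
    then show "w \<in> ?W"
      using x A(1) by (auto simp: coord_space_def)
  qed
  from assms obtain x h y where r: "r = four_block_mat x h (0\<^sub>m q p) y" "x \<in> carrier_mat p p"
    "y \<in> carrier_mat q q" "h \<in> carrier_mat p q" "det x * det y = 1"
    unfolding parabolic_SL_def by auto
  then have "det x \<noteq> 0" by auto
  then obtain z where z: "z \<in> carrier_mat p p" "x * z = 1\<^sub>m p"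
    using obtain_inverse_mat[OF r(2)] by metis
  \<comment> \<open>Only the block \<open>x\<close> is inverted. Then \<open>r * d\<close> has the
    identity as its upper left block and fixes every vector of \<open>?W\<close>, so
    \<open>d\<close> applied to \<open>v\<close> is a preimage of \<open>v\<close> under
    \<open>r\<close>.\<close>
  define d where "d = four_block_mat z (0\<^sub>m p q) (0\<^sub>m q p) (1\<^sub>m q)"
  have d: "d \<in> carrier_mat ?n ?n" and rc: "r \<in> carrier_mat ?n ?n"
    using z r by (auto simp: d_def)
  have rd: "r * d = four_block_mat (1\<^sub>m p) h (0\<^sub>m q p) y"
    unfolding r(1) d_def
    using r z by (subst mult_four_block_mat[of _ p p _ q _ q]) auto
  have "v \<in> (\<lambda>v. r *\<^sub>v v) ` ?W" if v: "v \<in> ?W" for v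
  proof -
    note vc = coord_space_carrier[OF v]
    have "(r * d) *\<^sub>v v = v"
    proof (rule eq_vecI)
      fix i assume "i < dim_vec v"
      then have i: "i < ?n" using vc by simp
      have "(r * d) $$ (i, k) * v $ k = (if k = i then v $ i else 0)" if "k < ?n" for k
        unfolding rd using r v i that by (auto simp: coord_space_def)
      then show "((r * d) *\<^sub>v v) $ i = v $ i"
        using i by (simp add: mult_vec_entry[OF mult_carrier_mat[OF rc d] vc])
    qed (use rc vc in auto)
    then have "v = r *\<^sub>v (d *\<^sub>v v)"
      using assoc_mult_mat_vec[OF rc d vc] by simp
    moreover have "d *\<^sub>v v \<in> ?W"
      using sub[OF d] v z by (auto simp: d_def)
    ultimately show ?thesis by blast
  qed
  moreover have "(\<lambda>v. r *\<^sub>v v) ` ?W \<subseteq> ?W"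
    using sub[of r] assms by (auto simp: parabolic_SL_iff)
  ultimately show ?thesis by blast
qed

lemma plane_of_coset_parabolic:
  assumes "g \<in> carrier (SL (p + q))"
  shows "plane_of_coset p (p + q) (g <#\<^bsub>SL (p + q)\<^esub> parabolic_SL p q) =
    (\<lambda>v. g *\<^sub>v v) ` coord_space (p + q) {..<p}"
proof -
  let ?n = "p + q"
  have g: "g \<in> carrier_mat ?n ?n"
    using assms by (simp add: carrier_SL_iff)
  have one: "1\<^sub>m ?n \<in> parabolic_SL p q"
    using one_levi_SL levi_SL_subset_parabolic by blast
  have eq: "vspan ?n (set (take p (cols m))) = (\<lambda>v. g *\<^sub>v v) ` coord_space ?n {..<p}"
    if m: "m \<in> g <#\<^bsub>SL ?n\<^esub> parabolic_SL p q" for m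
  proof -
    obtain r where r: "r \<in> parabolic_SL p q" "m = g * r"
      using m unfolding l_coset_SL by blast
    then have rc: "r \<in> carrier_mat ?n ?n"
      by (simp add: parabolic_SL_iff)
    show ?thesis
      unfolding r(2) vspan_take_cols[OF mult_carrier_mat[OF g rc] le_add1] image_coord_space_mult[OF g rc]
        parabolic_SL_image_coord_space[OF r(1)] ..
  qed
  have gP: "g \<in> g <#\<^bsub>SL ?n\<^esub> parabolic_SL p q"
    unfolding l_coset_SL using g by (intro image_eqI[OF _ one]) simp
  have "plane_of_coset p ?n (g <#\<^bsub>SL ?n\<^esub> parabolic_SL p q) = vspan ?n (set (take p (cols g)))"
    unfolding plane_of_coset_def by (rule on_class_eq[OF gP]) (simp only: eq eq[OF gP])
  then show ?thesis
    unfolding eq[OF gP] .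
qed

lemma borel_SL_subset: "borel_SL n \<subseteq> borel_GL n"
  by (auto simp: borel_SL_def borel_GL_def carrier_SL_iff)

lemma borel_GL_scale_SL:
  assumes "T \<in> borel_GL n" "n > 0"
  obtains c where "c \<noteq> 0" "c \<cdot>\<^sub>m T \<in> borel_SL n"
proof -
  note T = borel_GLD[OF assms(1)]
  obtain c where c: "c \<noteq> 0" "c ^ n * det T = 1"
    using exists_root_inverse[OF T(3) assms(2)] .
  have "det (c \<cdot>\<^sub>m T) = 1"
    using c T(1) by (simp add: det_smult)
  moreover have "c \<cdot>\<^sub>m T \<in> borel_GL n"
    using borel_GL_smult[OF assms(1) c(1)] .
  ultimately have "c \<cdot>\<^sub>m T \<in> borel_SL n"
    by (auto simp: borel_SL_def borel_GL_def carrier_SL_iff)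
  with c(1) that show ?thesis by blast
qed

lemma flag_of_coset_borel:
  assumes "g \<in> carrier (SL n)"
  shows "flag_of_coset n (g <#\<^bsub>SL n\<^esub> borel_SL n) = flag n (cols g)"
  unfolding flag_of_coset_def
proof (rule on_class_eq)
  have g: "g \<in> carrier_mat n n"
    using assms by (simp add: carrier_SL_iff)
  have "1\<^sub>m n \<in> borel_SL n"
    by (simp add: borel_SL_def carrier_SL_iff)
  then show "g \<in> g <#\<^bsub>SL n\<^esub> borel_SL n"
    unfolding l_coset_SL using g by (force simp: image_iff)
  show "flag n (cols m) = flag n (cols g)" if "m \<in> g <#\<^bsub>SL n\<^esub> borel_SL n" for m
    using that flag_cols_mult_borel[OF g] borel_SL_subset by (auto simp: l_coset_SL)
qed

text \<open>Scaling \<open>T\<close> to determinant 1 leaves the image of a coordinate subspace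
  unchanged, so the orbit under \<open>borel_SL\<close> may be tested with all of
  \<open>borel_GL\<close>.\<close>

lemma coset_in_schubert_cell_iff:
  assumes "g \<in> carrier (SL (p + q))" "J \<subseteq> {..<p + q}" "p + q > 0"
  shows "g <#\<^bsub>SL (p + q)\<^esub> parabolic_SL p q \<in> schubert_cell p q (unit_vec (p + q) ` J) \<longleftrightarrow>
    (\<exists>T\<in>borel_GL (p + q). (\<lambda>v. g *\<^sub>v v) ` coord_space (p + q) {..<p} = (\<lambda>v. T *\<^sub>v v) ` coord_space (p + q) J)"
proof -
  have "g <#\<^bsub>SL (p + q)\<^esub> parabolic_SL p q \<in> lcosets\<^bsub>SL (p + q)\<^esub> (parabolic_SL p q)"
    using assms(1) by (auto simp: LCOSETS_def)
  then have "g <#\<^bsub>SL (p + q)\<^esub> parabolic_SL p q \<in> schubert_cell p q (unit_vec (p + q) ` J) \<longleftrightarrow>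
    (\<exists>b\<in>borel_SL (p + q). (\<lambda>v. g *\<^sub>v v) ` coord_space (p + q) {..<p} = (\<lambda>v. b *\<^sub>v v) ` coord_space (p + q) J)"
    unfolding schubert_cell_def
    by (simp add: plane_of_coset_parabolic[OF assms(1)] vspan_unit_vecs[OF assms(2)] act_space_def)
  also have "\<dots> \<longleftrightarrow> (\<exists>T\<in>borel_GL (p + q). (\<lambda>v. g *\<^sub>v v) ` coord_space (p + q) {..<p} = (\<lambda>v. T *\<^sub>v v) ` coord_space (p + q) J)"
    (is "?L \<longleftrightarrow> ?R")
  proof
    assume ?R
    then obtain T where T: "T \<in> borel_GL (p + q)"
      "(\<lambda>v. g *\<^sub>v v) ` coord_space (p + q) {..<p} = (\<lambda>v. T *\<^sub>v v) ` coord_space (p + q) J" by auto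
    obtain c where "c \<noteq> 0" "c \<cdot>\<^sub>m T \<in> borel_SL (p + q)"
      using borel_GL_scale_SL[OF T(1) assms(3)] .
    with T show ?L
      using image_coord_space_smult[OF borel_GLD(1)[OF T(1)], of c J] by metis
  qed (use borel_SL_subset in blast)
  finally show ?thesis .
qed

subsection \<open>Clan matrices\<close>

definition matched :: "clan_symbol list \<Rightarrow> bool" where
  "matched c \<longleftrightarrow> (\<forall>a. Label a \<in> set c \<longrightarrow> count_list c (Label a) = 2)"

abbreviation is_label :: "clan_symbol \<Rightarrow> bool" where
  "is_label s \<equiv> s \<noteq> PlusSign \<and> s \<noteq> MinusSign"

text \<open>This set encodes the base clan: the clans in the sect of \<open>I\<close> are those
  whose \<open>plus_set\<close> is the index set of \<open>I\<close>.\<close>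

definition plus_set :: "clan_symbol list \<Rightarrow> nat set" where
  "plus_set c = {i. i < length c \<and> default_sign c i = PlusSign}"

text \<open>The matrix of \<theta> in the basis of clan vectors, as
  \<open>sign_mat_mult_clan_vec_mat\<close> shows.\<close>

definition clan_mat :: "clan_symbol list \<Rightarrow> complex mat" where
  "clan_mat c = mat (length c) (length c) (\<lambda>(r, s).
     if c ! s = PlusSign then of_bool (r = s)
     else if c ! s = MinusSign then - of_bool (r = s)
     else of_bool (r = mate c s))"

text \<open>The entries of the clan matrix strictly below the diagonal.\<close>

definition pair_mat :: "clan_symbol list \<Rightarrow> complex mat" where
  "pair_mat c = mat (length c) (length c) (\<lambda>(r, s).
     of_bool (is_label (c ! s) \<and> s \<notin> plus_set c \<and> r = mate c s))"

section \<open>Matching positions and default signatures\<close>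

lemma is_labelE:
  assumes "is_label s"
  obtains a where "s = Label a"
  using assms by (cases s) auto

lemma count_list_card: "count_list c x = card {i. i < length c \<and> c ! i = x}"
  unfolding count_list_eq_length_filter length_filter_conv_card
  by (rule arg_cong[of _ _ card]) auto

lemma matched_partner:
  assumes c: "matched c" and i: "i < length c" "is_label (c ! i)"
  shows "\<exists>!j. j < length c \<and> j \<noteq> i \<and> c ! j = c ! i"
proof -
  obtain a where a: "c ! i = Label a"
    using i(2) by (rule is_labelE)
  then have "Label a \<in> set c"
    using i(1) by (metis nth_mem)
  then have "card {k. k < length c \<and> c ! k = Label a} = 2"
    using c count_list_card[of c "Label a"] by (simp add: matched_def)
  moreover have "{k. k < length c \<and> c ! k = Label a} =
      insert i {j. j < length c \<and> j \<noteq> i \<and> c ! j = c ! i}"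
    using i(1) a by auto
  ultimately have "card {j. j < length c \<and> j \<noteq> i \<and> c ! j = c ! i} = 1"
    by (simp add: card_insert_if)
  then obtain j where "{j. j < length c \<and> j \<noteq> i \<and> c ! j = c ! i} = {j}"
    by (rule card_1_singletonE)
  then show ?thesis
    by (intro ex1I[of _ j]) blast+
qed

lemma mate_props:
  assumes c: "matched c" and i: "i < length c" "is_label (c ! i)"
  shows "mate c i < length c" "mate c i \<noteq> i" "c ! mate c i = c ! i"
    and "\<And>j. j < length c \<Longrightarrow> j \<noteq> i \<Longrightarrow> c ! j = c ! i \<Longrightarrow> mate c i = j"
    and "mate c (mate c i) = i"
proof -
  note ex1 = matched_partner[OF c i]
  show *: "mate c i < length c" "mate c i \<noteq> i" "c ! mate c i = c ! i"
    using theI'[OF ex1] by (auto simp: mate_def)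
  show "\<And>j. j < length c \<Longrightarrow> j \<noteq> i \<Longrightarrow> c ! j = c ! i \<Longrightarrow> mate c i = j"
    unfolding mate_def by (rule the1_equality[OF ex1]) auto
  have "is_label (c ! mate c i)"
    using i(2) *(3) by simp
  then show "mate c (mate c i) = i"
    unfolding mate_def[of c "mate c i"]
    by (intro the1_equality[OF matched_partner[OF c *(1)]]) (use * i in auto)
qed

lemma plus_set_sign:
  assumes "i < length c"
  shows "c ! i = PlusSign \<Longrightarrow> i \<in> plus_set c" "c ! i = MinusSign \<Longrightarrow> i \<notin> plus_set c"
  using assms by (auto simp: plus_set_def default_sign_def)

lemma plus_set_label:
  assumes c: "matched c" and i: "i < length c" "is_label (c ! i)"
  shows "i \<in> plus_set c \<longleftrightarrow> mate c i < i"
proof -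
  obtain a where a: "c ! i = Label a"
    using i(2) by (rule is_labelE)
  note m = mate_props[OF c i]
  have "(\<exists>j<i. c ! j = Label a) \<longleftrightarrow> mate c i < i"
    using m(3,4) i(1) a by (metis less_trans nat_neq_iff)
  then show ?thesis
    using a i(1) by (auto simp: plus_set_def default_sign_def)
qed

lemma plus_set_mate:
  assumes c: "matched c" and i: "i < length c" "is_label (c ! i)"
  shows "mate c i \<in> plus_set c \<longleftrightarrow> i \<notin> plus_set c"
proof -
  note m = mate_props[OF c i]
  have "is_label (c ! mate c i)" using i m(3) by simp
  from plus_set_label[OF c m(1) this] plus_set_label[OF c i] m(2,5) show ?thesis by auto
qed

lemma clan_mat_carrier: "clan_mat c \<in> carrier_mat (length c) (length c)"
  by (simp add: clan_mat_def)

text \<open>Restricted to a matching pair \<open>i < j\<close>, with signature - at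
  \<open>i\<close>, the identity reads [[1,1],[0,1]] [[-1,0],[1,1]] = [[0,1],[1,0]] [[1,1],[0,1]].
  At a sign all blocks have size 1. The extra entry of \<open>T\<close> lies in row \<open>i\<close>
  and column \<open>j\<close>, hence above the diagonal.\<close>

lemma clan_mat_conj_sign_plus_pair:
  assumes "matched c"
  obtains T where "T \<in> borel_GL (length c)"
    "T * (sign_mat (length c) (plus_set c) + pair_mat c) = clan_mat c * T"
proof -
  let ?n = "length c"
  define D where "D = sign_mat ?n (plus_set c) + pair_mat c"
  define T :: "complex mat" where "T = mat ?n ?n (\<lambda>(r, s).
    of_bool (r = s) + of_bool (is_label (c ! r) \<and> r \<notin> plus_set c \<and> s = mate c r))"
  have Tc: "T \<in> carrier_mat ?n ?n" and Dc: "D \<in> carrier_mat ?n ?n"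
    by (auto simp: T_def D_def pair_mat_def)
  note mt = mate_props[OF assms] and ps = plus_set_mate[OF assms]
  have "T \<in> borel_GL ?n"
  proof (rule borel_GLI)
    show "T $$ (i, j) = 0" if "j < i" "i < ?n" for i j
      using that plus_set_label[OF assms, of i] by (auto simp: T_def)
    show "T $$ (i, i) \<noteq> 0" if "i < ?n" for i
      using that mt(2)[of i] by (auto simp: T_def)
  qed (rule Tc)
  moreover have "T * D = clan_mat c * T"
  proof (rule eq_matI)
    fix r s assume "r < dim_row (clan_mat c * T)" "s < dim_col (clan_mat c * T)"
    then have r: "r < ?n" and s: "s < ?n"
      using Tc by (auto simp: clan_mat_def)
    have D: "D $$ (t, s) = (if t = s then (if s \<in> plus_set c then 1 else - 1) else 0) +
       of_bool (is_label (c ! s) \<and> s \<notin> plus_set c \<and> t = mate c s)" if "t < ?n" for t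
      using that s by (auto simp: D_def sign_mat_def pair_mat_def)
    have "T $$ (r, t) * D $$ (t, s) = (if t = r then D $$ (r, s) else 0) +
        (if t = mate c r then (if is_label (c ! r) \<and> r \<notin> plus_set c then D $$ (mate c r, s) else 0) else 0)"
      if "t < ?n" for t
      using that r mt(2)[OF r] by (auto simp: T_def)
    then have "(T * D) $$ (r, s) = D $$ (r, s) +
        (if is_label (c ! r) \<and> r \<notin> plus_set c then D $$ (mate c r, s) else 0)"
      using r mt(1)[OF r] by (auto simp: mult_mat_entry[OF Tc Dc r s] sum.distrib)
    \<comment> \<open>For \<open>s\<close> in \<open>plus_set c\<close> the off-diagonal entry in
      column \<open>s\<close> of \<open>T\<close> sits in row \<open>mate c s\<close>, and the swap
      moves it to row \<open>s\<close>.\<close>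
    moreover have "clan_mat c $$ (r, t) * T $$ (t, s) = (if t = s then clan_mat c $$ (r, s) else 0) +
        (if t = mate c s then (if is_label (c ! s) \<and> s \<in> plus_set c then of_bool (r = s) else 0) else 0)"
      if "t < ?n" for t
      using that r s mt(1,2,3,5)[OF s] mt(2,5)[OF that] ps[OF s] ps[OF that] mt(3)[OF that]
      by (auto simp: T_def clan_mat_def)
    then have "(clan_mat c * T) $$ (r, s) = clan_mat c $$ (r, s) +
        (if is_label (c ! s) \<and> s \<in> plus_set c then of_bool (r = s) else 0)"
      using s mt(1)[OF s] by (auto simp: mult_mat_entry[OF clan_mat_carrier Tc r s] sum.distrib)
    moreover have "D $$ (r, s) + (if is_label (c ! r) \<and> r \<notin> plus_set c then D $$ (mate c r, s) else 0) =
      clan_mat c $$ (r, s) + (if is_label (c ! s) \<and> s \<in> plus_set c then of_bool (r = s) else 0)"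
    proof -
      have M: "clan_mat c $$ (r, s) = (if c ! s = PlusSign then of_bool (r = s)
          else if c ! s = MinusSign then - of_bool (r = s) else of_bool (r = mate c s))"
        using r s by (simp add: clan_mat_def)
      show ?thesis
      proof (cases "is_label (c ! s)")
        case False
        then have "mate c r \<noteq> s" if "is_label (c ! r)"
          using mt(3)[OF r that] that by auto
        with False show ?thesis
          using D[OF r] D[OF mt(1)[OF r]] plus_set_sign[OF s] M by (cases "c ! s") auto
      next
        case True
        have rs: "r = mate c s \<longleftrightarrow> is_label (c ! r) \<and> mate c r = s" "mate c r = mate c s \<and> is_label (c ! r) \<longleftrightarrow> r = s \<and> is_label (c ! r)"
          using mt(3,5)[OF s True] mt(3,5)[OF r] True by auto
        have ns: "mate c s \<noteq> s" "s \<in> plus_set c \<Longrightarrow> mate c s \<notin> plus_set c" "s \<notin> plus_set c \<Longrightarrow> mate c s \<in> plus_set c"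
          using mt(2)[OF s True] ps[OF s True] by auto
        show ?thesis
        proof (cases "is_label (c ! r) \<and> r \<notin> plus_set c")
          case r': True
          show ?thesis
            unfolding M D[OF r] D[OF mt(1)[OF r conjunct1[OF r']]]
            using True r' rs ns ps[OF r conjunct1[OF r']] by auto
        next
          case r': False
          then show ?thesis
            unfolding M D[OF r] using True rs ns by auto
        qed
      qed
    qed
    ultimately show "(T * D) $$ (r, s) = (clan_mat c * T) $$ (r, s)" by simp
  qed (use Tc Dc in \<open>auto simp: clan_mat_def\<close>)
  ultimately show ?thesis
    using that unfolding D_def by blast
qed

text \<open>If \<open>i\<close> is the least point that is moved, then \<open>f i < i\<close> is
  fixed, so \<open>f\<close> takes the same value at \<open>f i\<close> and at \<open>i\<close>.
  Applied to a composition of two involutions, this makes them equal.\<close>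

lemma nonincreasing_inj_id:
  fixes f :: "nat \<Rightarrow> nat"
  assumes "\<And>i. i < n \<Longrightarrow> f i \<le> i" "inj_on f {..<n}" "i < n"
  shows "f i = i"
  using assms(3)
proof (induction i rule: less_induct)
  case (less i)
  show ?case
  proof (rule ccontr)
    assume "f i \<noteq> i"
    then have "f i < i"
      using assms(1)[OF less.prems] by simp
    then have "f (f i) = f i"
      using less by simp
    then show False
      using \<open>f i < i\<close> less.prems inj_onD[OF assms(2), of "f i" i] by simp
  qed
qed

text \<open>
  With \<open>\<tau>\<close> for the underlying involutions, nonzero diagonal entries of \<open>T\<close> force the entry of \<open>T\<close> at row
  \<open>\<tau>\<^sub>d (\<tau>\<^sub>c s)\<close> and column \<open>s\<close> to be nonzero, hence \<open>\<tau>\<^sub>d (\<tau>\<^sub>c s) \<le> s\<close> for all \<open>s\<close>.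
\<close>

lemma clan_mat_conj_relabelling:
  assumes c: "matched c" and d: "matched d" and len: "length d = length c"
    and T: "T \<in> borel_GL (length c)" "T * clan_mat c = clan_mat d * T"
  shows "(c, d) \<in> relabelling"
proof -
  let ?n = "length c"
  \<comment> \<open>With \<tau> the identity at signs and \<open>e\<close> equal to 1 at labels,
    clan matrices get one uniform description: column \<open>s\<close> has the single entry
    \<open>e x s\<close>, in row \<open>\<tau> x s\<close>.\<close>
  define \<tau> where "\<tau> = (\<lambda>x s. if is_label (x ! s) then mate x s else s)"
  define e where "e = (\<lambda>x s. if x ! s = MinusSign then - 1 else 1 :: complex)"
  have e: "e x s \<noteq> 0" for x s
    by (simp add: e_def)
  have \<tau>: "\<tau> x s < length x" "\<tau> x (\<tau> x s) = s" if "matched x" "s < length x" for x s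
    using mate_props[OF that] that(2) by (auto simp: \<tau>_def)
  have entry: "clan_mat x $$ (r, s) = (if r = \<tau> x s then e x s else 0)"
    if "r < length x" "s < length x" for x r s
    using that by (auto simp: clan_mat_def \<tau>_def e_def)
  note Tc = borel_GLD(1)[OF T(1)]
  have cc: "clan_mat c \<in> carrier_mat ?n ?n" and dc: "clan_mat d \<in> carrier_mat ?n ?n"
    using clan_mat_carrier[of c] clan_mat_carrier[of d] len by auto
  \<comment> \<open>Each entry of the two products is a single term, because a clan matrix has one
    nonzero entry in every row and column.\<close>
  have eq: "T $$ (r, \<tau> c s) * e c s = e d (\<tau> d r) * T $$ (\<tau> d r, s)" if "r < ?n" "s < ?n" for r s
  proof -
    have "T $$ (r, t) * clan_mat c $$ (t, s) = (if t = \<tau> c s then T $$ (r, \<tau> c s) * e c s else 0)" if "t < ?n" for t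
      using entry[OF that \<open>s < ?n\<close>] by simp
    then have "(T * clan_mat c) $$ (r, s) = T $$ (r, \<tau> c s) * e c s"
      using \<tau>(1)[OF c \<open>s < ?n\<close>] by (simp add: mult_mat_entry[OF Tc cc that])
    moreover have "clan_mat d $$ (r, t) * T $$ (t, s) = (if t = \<tau> d r then e d (\<tau> d r) * T $$ (\<tau> d r, s) else 0)"
      if "t < ?n" for t
      using entry[of r d t] \<tau>(2)[OF d] that \<open>r < ?n\<close> len by auto
    then have "(clan_mat d * T) $$ (r, s) = e d (\<tau> d r) * T $$ (\<tau> d r, s)"
      using \<tau>(1)[OF d] \<open>r < ?n\<close> len by (simp add: mult_mat_entry[OF dc Tc that])
    ultimately show ?thesis
      using T(2) by simp
  qed
  have \<tau>_eq: "\<tau> d s = \<tau> c s" if s: "s < ?n" for s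
  proof -
    have le: "\<tau> d (\<tau> c s) \<le> s" if s: "s < ?n" for s
    proof (rule ccontr)
      assume "\<not> \<tau> d (\<tau> c s) \<le> s"
      then have "T $$ (\<tau> d (\<tau> c s), s) = 0"
        using borel_GLD(4)[OF T(1), of s "\<tau> d (\<tau> c s)"] \<tau>(1)[OF d] \<tau>(1)[OF c s] len by simp
      then have "T $$ (\<tau> c s, \<tau> c s) = 0"
        using eq[OF \<tau>(1)[OF c s] s] e[of c s] by simp
      then show False
        using borel_GL_diag[OF T(1) \<tau>(1)[OF c s]] by simp
    qed
    have "inj_on (\<lambda>s. \<tau> d (\<tau> c s)) {..<?n}"
      by (rule inj_on_inverseI[of _ "\<lambda>s. \<tau> c (\<tau> d s)"]) (use \<tau>[OF c] \<tau>[OF d] len in auto)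
    then have "\<tau> d (\<tau> c s) = s"
      using nonincreasing_inj_id[OF le _ s] by simp
    then show ?thesis
      using \<tau>(2)[OF d] \<tau>(1)[OF c s] len by metis
  qed
  have fix_iff: "\<tau> x s = s \<longleftrightarrow> \<not> is_label (x ! s)" if "matched x" "s < length x" for x s
    using mate_props(2)[OF that] by (auto simp: \<tau>_def)
  \<comment> \<open>At a common fixed point, \<open>eq\<close> on the diagonal compares the two
    signs, both multiplied by the nonzero entry \<open>T $$ (s, s)\<close>.\<close>
  have sign: "e c s = e d s" if s: "s < ?n" "\<not> is_label (c ! s)" for s
  proof -
    have "\<tau> c s = s" "\<tau> d s = s"
      using fix_iff[OF c s(1)] s \<tau>_eq by auto
    with eq[OF s(1) s(1)] borel_GL_diag[OF T(1) s(1)] show ?thesis by simp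
  qed
  have lab: "is_label (c ! s) \<longleftrightarrow> is_label (d ! s)" if "s < ?n" for s
    using fix_iff[OF c that] fix_iff[OF d, of s] \<tau>_eq[OF that] that len by metis
  have signs: "c ! s = PlusSign \<longleftrightarrow> d ! s = PlusSign" "c ! s = MinusSign \<longleftrightarrow> d ! s = MinusSign" if "s < ?n" for s
    using lab[OF that] sign[OF that] by (auto simp: e_def split: if_splits)
  have lab_eq: "x ! i = x ! j \<longleftrightarrow> i = j \<or> j = \<tau> x i"
    if "matched x" "i < length x" "j < length x" "is_label (x ! i)" for x i j
    using mate_props(3)[OF that(1,2,4)] mate_props(4)[OF that(1,2,4,3)] that(4) unfolding \<tau>_def by metis
  have "c ! i = c ! j \<longleftrightarrow> d ! i = d ! j" if "i < ?n" "j < ?n" for i j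
  proof (cases "is_label (c ! i)")
    case True
    then show ?thesis
      using lab_eq[OF c that True] lab_eq[OF d _ _ ] lab[OF that(1)] \<tau>_eq[OF that(1)] that len by auto
  next
    case False
    then show ?thesis
      using signs[OF that(1)] signs[OF that(2)] by metis
  qed
  with signs len show ?thesis
    by (simp add: relabelling_def)
qed

subsection \<open>Reduction under block-diagonal triangular matrices\<close>

text \<open>With S = \<open>sign_mat n J\<close>, such an \<open>H\<close> satisfies S H = H = - H S
  and H H = 0, so S + H is again an involution.\<close>

definition block_strict :: "nat \<Rightarrow> nat set \<Rightarrow> 'a::zero mat \<Rightarrow> bool" where
  "block_strict n J H \<longleftrightarrow> H \<in> carrier_mat n n \<and>
     (\<forall>i<n. \<forall>j<n. H $$ (i, j) \<noteq> 0 \<longrightarrow> i \<in> J \<and> j \<notin> J)"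

text \<open>Over the complex numbers these are the matrices that commute with
  \<open>sign_mat n J\<close>; conjugation by an invertible one keeps the sign matrix and acts on
  the strict block alone.\<close>

definition block_diag :: "nat \<Rightarrow> nat set \<Rightarrow> 'a::zero mat \<Rightarrow> bool" where
  "block_diag n J H \<longleftrightarrow> H \<in> carrier_mat n n \<and>
     (\<forall>i<n. \<forall>j<n. H $$ (i, j) \<noteq> 0 \<longrightarrow> (i \<in> J \<longleftrightarrow> j \<in> J))"

text \<open>The invariant of an elimination that runs from the last row upward: vacuous at
  \<open>k = n\<close>, and at \<open>k = 0\<close> it describes partial permutation matrices. The
  column condition also covers the rows above \<open>k\<close>, so a pivot column already used is
  zero in the rows still to be treated.\<close>

definition rows_reduced :: "nat \<Rightarrow> nat \<Rightarrow> 'a::zero_neq_one mat \<Rightarrow> bool" where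
  "rows_reduced n k H \<longleftrightarrow> (\<forall>i<n. \<forall>j<n. k \<le> i \<longrightarrow> H $$ (i, j) \<noteq> 0 \<longrightarrow>
     H $$ (i, j) = 1 \<and> (\<forall>j'<n. j' \<noteq> j \<longrightarrow> H $$ (i, j') = 0) \<and> (\<forall>i'<n. i' \<noteq> i \<longrightarrow> H $$ (i', j) = 0))"

lemma block_strict_carrier: "block_strict n J H \<Longrightarrow> H \<in> carrier_mat n n"
  by (simp add: block_strict_def)

lemma block_diag_mult:
  fixes A B :: "'a::semiring_0 mat"
  assumes A: "block_diag n J A" and B: "block_diag n J B"
  shows "block_diag n J (A * B)"
proof -
  have c: "A \<in> carrier_mat n n" "B \<in> carrier_mat n n"
    using assms by (auto simp: block_diag_def)
  have "(A * B) $$ (i, j) = 0" if ij: "i < n" "j < n" "(i \<in> J) \<noteq> (j \<in> J)" for i j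
  proof -
    have "A $$ (i, k) * B $$ (k, j) = 0" if "k < n" for k
      using A B ij that unfolding block_diag_def by (metis mult_zero_left mult_zero_right)
    then show ?thesis
      using ij by (simp add: mult_mat_entry[OF c])
  qed
  with c show ?thesis
    by (auto simp: block_diag_def simp del: index_mult_mat(1))
qed

lemma block_diag_one: "block_diag n J (1\<^sub>m n)"
  by (auto simp: block_diag_def)

text \<open>
  The leftmost nonzero entry \<open>a\<close> of row \<open>k\<close>, in column \<open>j\<close>, is the pivot. Column \<open>k\<close> of \<open>l\<close> subtracts multiples of
  row \<open>k\<close> from the rows above it; row \<open>j\<close> of \<open>l\<close> is row \<open>k\<close> of \<open>H\<close>, so that passing to \<open>H' * l\<close> restores row \<open>k\<close>.
\<close>

lemma reduce_row:
  fixes H :: "'a::field mat"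
  assumes H: "block_strict n J H" "rows_reduced n (Suc k) H" and k: "k < n"
  obtains l H' where "l \<in> borel_GL n" "block_diag n J l" "block_strict n J H'" "rows_reduced n k H'"
    "l * H = H' * l"
proof (cases "\<forall>j<n. H $$ (k, j) = 0")
  case True
  then have "rows_reduced n k H"
    using H(2) unfolding rows_reduced_def by (metis le_antisym not_less_eq_eq)
  moreover have "1\<^sub>m n * H = H * 1\<^sub>m n"
    using block_strict_carrier[OF H(1)] by simp
  ultimately show ?thesis
    using that borel_GL_one block_diag_one H(1) by blast
next
  case False
  define j where "j = (LEAST j. j < n \<and> H $$ (k, j) \<noteq> 0)"
  have j: "j < n" "H $$ (k, j) \<noteq> 0"
    using LeastI_ex[of "\<lambda>j. j < n \<and> H $$ (k, j) \<noteq> 0"] False unfolding j_def by auto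
  have before: "H $$ (k, t) = 0" if "t < j" for t
    using not_less_Least[of t "\<lambda>j. j < n \<and> H $$ (k, j) \<noteq> 0"] that j(1) unfolding j_def[symmetric] by auto
  have Hc: "H \<in> carrier_mat n n"
    using H by (simp add: block_strict_def)
  have Hs: "H $$ (s, t) = 0" if "s < n" "t < n" "s \<notin> J \<or> t \<in> J" for s t
    using H(1) that unfolding block_strict_def by blast
  have kj: "k \<in> J" "j \<notin> J" "k \<noteq> j"
    using Hs[OF k j(1)] j(2) by auto
  \<comment> \<open>A nonzero entry below the pivot would, by the invariant, be the only one in its
    column, against \<open>H $$ (k, j)\<close> being nonzero.\<close>
  have below: "H $$ (i, j) = 0" if "k < i" "i < n" for i
  proof (rule ccontr)
    assume "H $$ (i, j) \<noteq> 0"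
    then have "H $$ (k, j) = 0"
      using H(2) that j(1) k unfolding rows_reduced_def by (metis Suc_leI nat_less_le)
    with j(2) show False ..
  qed
  define a where "a = H $$ (k, j)"
  define l where "l = mat n n (\<lambda>(i, t). if i = j then H $$ (k, t)
    else (if i = t then 1 else 0) + (if t = k \<and> i \<noteq> k then - H $$ (i, j) / a else 0))"
  \<comment> \<open>Row \<open>k\<close> and column \<open>j\<close> keep only a 1 at their
    crossing; elsewhere this is the usual elimination with pivot \<open>a\<close>.\<close>
  define H' where "H' = mat n n (\<lambda>(i, s). if s = j then (if i = k then 1 else 0)
    else if i = k then 0 else H $$ (i, s) - H $$ (i, j) * H $$ (k, s) / a)"
  have lc: "l \<in> carrier_mat n n" and H'c: "H' \<in> carrier_mat n n"
    by (auto simp: l_def H'_def)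
  have a: "a \<noteq> 0" using j(2) by (simp add: a_def)
  have l_entry: "l $$ (i, t) = (if i = j then H $$ (k, t)
    else (if i = t then 1 else 0) + (if t = k \<and> i \<noteq> k then - H $$ (i, j) / a else 0))"
    if "i < n" "t < n" for i t
    using that by (simp add: l_def)
  have H'_entry: "H' $$ (i, s) = (if s = j then (if i = k then 1 else 0)
    else if i = k then 0 else H $$ (i, s) - H $$ (i, j) * H $$ (k, s) / a)" if "i < n" "s < n" for i s
    using that by (simp add: H'_def)
  have H's: "H' $$ (s, t) = 0" if "s < n" "t < n" "s \<notin> J \<or> t \<in> J" for s t
    using that kj Hs[OF that(1,2)] Hs[OF that(1) j(1)] Hs[OF k that(2)] by (auto simp: H'_entry)
  \<comment> \<open>Row \<open>j\<close> of \<open>l\<close> vanishes left of the diagonal since the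
    pivot is leftmost in row \<open>k\<close> of \<open>H\<close>; column \<open>k\<close> vanishes
    below the diagonal by \<open>below\<close>. The diagonal entries are \<open>a\<close> at
    \<open>j\<close> and 1 elsewhere.\<close>
  have "l \<in> borel_GL n"
  proof (rule borel_GLI)
    show "l $$ (i, t) = 0" if "t < i" "i < n" for i t
      using that before[of t] below[of i] k by (auto simp: l_entry)
    show "l $$ (i, i) \<noteq> 0" if "i < n" for i
      using that a by (auto simp: l_entry a_def)
  qed (rule lc)
  moreover have "block_diag n J l"
  proof -
    have "l $$ (i, t) = 0" if "i < n" "t < n" "(i \<in> J) \<noteq> (t \<in> J)" for i t
      using that kj Hs[OF k that(2)] Hs[OF that(1) j(1)] by (auto simp: l_entry)
    then show ?thesis
      using lc by (auto simp: block_diag_def)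
  qed
  moreover have "block_strict n J H'"
    using H'c H's by (auto simp: block_strict_def)
  moreover have "rows_reduced n k H'"
    unfolding rows_reduced_def
  proof (intro allI impI)
    fix i s assume idx: "i < n" "s < n" "k \<le> i" "H' $$ (i, s) \<noteq> 0"
    show "H' $$ (i, s) = 1 \<and> (\<forall>s'<n. s' \<noteq> s \<longrightarrow> H' $$ (i, s') = 0) \<and> (\<forall>i'<n. i' \<noteq> i \<longrightarrow> H' $$ (i', s) = 0)"
    proof (cases "i = k")
      case True
      then have "s = j"
        using idx by (auto simp: H'_entry split: if_splits)
      with True idx k show ?thesis by (auto simp: H'_entry)
    next
      case False
      \<comment> \<open>Rows below \<open>k\<close> stay as they were, since they are zero in the
        pivot column. Their own pivot columns are zero in row \<open>k\<close>, so nothing is added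
        to them either.\<close>
      then have i: "Suc k \<le> i" "H $$ (i, j) = 0"
        using idx below by auto
      then have s: "s \<noteq> j" "H $$ (i, s) \<noteq> 0"
        using idx False by (auto simp: H'_entry split: if_splits)
      then have *: "H $$ (i, s) = 1" "\<And>s'. s' < n \<Longrightarrow> s' \<noteq> s \<Longrightarrow> H $$ (i, s') = 0"
        "\<And>i'. i' < n \<Longrightarrow> i' \<noteq> i \<Longrightarrow> H $$ (i', s) = 0"
        using H(2) idx(1,2) i(1) unfolding rows_reduced_def by blast+
      show ?thesis
        using idx False s i(2) * k by (auto simp: H'_entry)
    qed
  qed
  moreover have "l * H = H' * l"
  proof (rule eq_matI)
    fix i s assume "i < dim_row (H' * l)" "s < dim_col (H' * l)"
    then have idx: "i < n" "s < n"
      using lc H'c by auto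
    \<comment> \<open>Row \<open>i\<close> of \<open>H'\<close> is supported outside
      \<open>J\<close>. There the rows of \<open>l\<close> are unit rows, because column
      \<open>j\<close> of \<open>H\<close> vanishes outside \<open>J\<close>; the exception is row
      \<open>j\<close>, a copy of row \<open>k\<close> of \<open>H\<close>.\<close>
    have right: "H' $$ (i, t) * l $$ (t, s) = (if t = j then (if i = k then H $$ (k, s) else 0) else 0)
      + (if t = s then (if s = j then 0 else H' $$ (i, s)) else 0)" if "t < n" for t
    proof (cases "t = j")
      case True
      then show ?thesis
        using idx that by (auto simp: H'_entry[of i j] l_entry[of j s])
    next
      case False
      then show ?thesis
        using idx that kj H's[of i t] Hs[of t j] j(1) by (cases "t \<in> J") (auto simp: l_entry)
    qed
    have "(H' * l) $$ (i, s) = (if i = k then H $$ (k, s) else 0) + (if s = j then 0 else H' $$ (i, s))"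
      using idx j(1) by (simp add: mult_mat_entry[OF H'c lc idx] right sum.distrib)
    moreover have "(l * H) $$ (i, s) = \<dots>"
    proof (cases "i = j")
      case True
      \<comment> \<open>Row \<open>j\<close> of \<open>l * H\<close> is row \<open>k\<close> of
        \<open>H * H\<close>, and \<open>H * H = 0\<close> for a strict block.\<close>
      have "l $$ (i, t) * H $$ (t, s) = 0" if "t < n" for t
        using True that idx Hs[of k t] Hs[of t s] k by (cases "t \<in> J") (auto simp: l_entry)
      then have "(l * H) $$ (i, s) = 0"
        by (simp add: mult_mat_entry[OF lc Hc idx] sum.neutral del: mult_eq_0_iff)
      then show ?thesis
        using True kj H's[of j s] idx by auto
    next
      case False
      have "l $$ (i, t) * H $$ (t, s) = (if t = i then H $$ (i, s) else 0) +
        (if t = k then (if i = k then 0 else - H $$ (i, j) / a * H $$ (k, s)) else 0)" if "t < n" for t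
        using False that idx by (auto simp: l_entry algebra_simps)
      then have "(l * H) $$ (i, s) = H $$ (i, s) + (if i = k then 0 else - H $$ (i, j) / a * H $$ (k, s))"
        using idx k by (simp add: mult_mat_entry[OF lc Hc idx] sum.distrib)
      then show ?thesis
        using idx a by (auto simp: H'_entry a_def)
    qed
    ultimately show "(l * H) $$ (i, s) = (H' * l) $$ (i, s)" by simp
  qed (use lc Hc H'c in auto)
  ultimately show ?thesis
    using that by blast
qed

text \<open>After \<open>m\<close> steps the last \<open>m\<close> rows are reduced; the conjugating
  matrices are multiplied together.\<close>

lemma reduce_rows:
  fixes H :: "'a::field mat"
  assumes H: "block_strict n J H"
  obtains l P where "l \<in> borel_GL n" "block_diag n J l" "block_strict n J P" "rows_reduced n 0 P"
    "l * H = P * l"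
proof -
  have "\<exists>l P. l \<in> borel_GL n \<and> block_diag n J l \<and> block_strict n J P \<and> rows_reduced n (n - m) P \<and>
    l * H = P * l" if "m \<le> n" for m
    using that
  proof (induction m)
    case 0
    have "rows_reduced n n H"
      by (simp add: rows_reduced_def)
    moreover have "1\<^sub>m n * H = H * 1\<^sub>m n"
      using block_strict_carrier[OF H] by simp
    ultimately show ?case
      using H borel_GL_one block_diag_one by (metis diff_zero)
  next
    case (Suc m)
    then obtain l P where l: "l \<in> borel_GL n" "block_diag n J l" "block_strict n J P"
      "rows_reduced n (n - m) P" "l * H = P * l" by auto
    have "n - m = Suc (n - Suc m)" "n - Suc m < n"
      using Suc.prems by auto
    then obtain l' P' where l': "l' \<in> borel_GL n" "block_diag n J l'" "block_strict n J P'"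
      "rows_reduced n (n - Suc m) P'" "l' * P = P' * l'"
      using reduce_row[OF l(3), of "n - Suc m"] l(4) by metis
    note c = borel_GLD(1)[OF l(1)] borel_GLD(1)[OF l'(1)]
    have c': "P \<in> carrier_mat n n" "P' \<in> carrier_mat n n" "H \<in> carrier_mat n n"
      using l(3) l'(3) H by (auto simp: block_strict_def)
    have "(l' * l) * H = l' * (P * l)"
      using c c' l(5)[symmetric] by (simp add: assoc_mult_mat[of _ n n _ n _ n])
    also have "\<dots> = (l' * P) * l"
      using c c' by (simp add: assoc_mult_mat[of _ n n _ n _ n])
    also have "\<dots> = P' * (l' * l)"
      unfolding l'(5) using c c' by (simp add: assoc_mult_mat[of _ n n _ n _ n])
    finally show ?case
      using l l' borel_GL_mult block_diag_mult by blast
  qed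
  from this[of n] show ?thesis
    using that by auto
qed

subsection \<open>Clan vectors and the normal form\<close>

lemma clan_seqsD:
  assumes "c \<in> clan_seqs p q"
  shows "length c = p + q" "matched c"
  using assms by (auto simp: clan_seqs_def matched_def)

lemma admissible_iff:
  "length c = p + q \<Longrightarrow> admissible p q c \<sigma> \<longleftrightarrow>
    \<sigma> permutes {0..<p + q} \<and> (\<forall>i<p + q. \<sigma> i < p \<longleftrightarrow> i \<in> plus_set c)"
  by (auto simp: admissible_def plus_set_def)

text \<open>Guarantees that the \<open>SOME\<close> in \<open>orbit_Q_seq\<close> picks an
  admissible \<sigma>. It is glued from a bijection of \<open>plus_set c\<close> with the first
  \<open>p\<close> indices and one of the complement with the remaining \<open>q\<close>.\<close>

lemma admissible_exists:
  assumes "length c = p + q" "card (plus_set c) = p"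
  shows "\<exists>\<sigma>. admissible p q c \<sigma>"
proof -
  let ?n = "p + q" and ?J = "plus_set c"
  have J: "?J \<subseteq> {0..<?n}" "finite ?J"
    using assms(1) by (auto simp: plus_set_def)
  obtain f where f: "bij_betw f ?J {0..<p}"
    using finite_same_card_bij[OF J(2), of "{0..<p}"] assms(2) by auto
  have "card ({0..<?n} - ?J) = card {p..<?n}"
    using J assms(2) by (simp add: card_Diff_subset)
  then obtain g where g: "bij_betw g ({0..<?n} - ?J) {p..<?n}"
    using finite_same_card_bij[of "{0..<?n} - ?J" "{p..<?n}"] by auto
  define \<sigma> where "\<sigma> = (\<lambda>i. if i \<in> ?J then f i else if i < ?n then g i else i)"
  have 1: "bij_betw \<sigma> ?J {0..<p}"
    using f by (rule bij_betw_cong[THEN iffD1, rotated]) (simp add: \<sigma>_def)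
  have 2: "bij_betw \<sigma> ({0..<?n} - ?J) {p..<?n}"
    using g by (rule bij_betw_cong[THEN iffD1, rotated]) (simp add: \<sigma>_def)
  have "bij_betw \<sigma> (?J \<union> ({0..<?n} - ?J)) ({0..<p} \<union> {p..<?n})"
    by (rule bij_betw_combine[OF 1 2]) auto
  moreover have "?J \<union> ({0..<?n} - ?J) = {0..<?n}" "{0..<p} \<union> {p..<?n} = {0..<?n}"
    using J by auto
  ultimately have "bij_betw \<sigma> {0..<?n} {0..<?n}"
    by simp
  then have "\<sigma> permutes {0..<?n}"
    by (rule bij_imp_permutes) (use J in \<open>auto simp: \<sigma>_def\<close>)
  moreover have "\<sigma> i < p \<longleftrightarrow> i \<in> ?J" if "i < ?n" for i
    using bij_betwE[OF 1] bij_betwE[OF 2] that by (cases "i \<in> ?J") (force simp: not_less)+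
  ultimately show ?thesis
    using admissible_iff[OF assms(1)] by blast
qed

definition clan_vec_mat :: "nat \<Rightarrow> clan_symbol list \<Rightarrow> (nat \<Rightarrow> nat) \<Rightarrow> complex mat" where
  "clan_vec_mat n c \<sigma> = mat n n (\<lambda>(r, s). clan_vec n c \<sigma> s $ r)"

lemma clan_vec_mat_carrier: "clan_vec_mat n c \<sigma> \<in> carrier_mat n n"
  by (simp add: clan_vec_mat_def)

lemma cols_clan_vec_mat: "cols (clan_vec_mat n c \<sigma>) = map (clan_vec n c \<sigma>) [0..<n]"
  unfolding cols_def
  by (rule map_cong) (auto simp: clan_vec_mat_def clan_vec_def intro!: eq_vecI)

lemma clan_vec_mat_entry:
  assumes "r < n" "s < n" "length c = n"
  shows "clan_vec_mat n c \<sigma> $$ (r, s) =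
    (if is_label (c ! s) then (if s \<in> plus_set c then of_bool (r = \<sigma> s) else - of_bool (r = \<sigma> s))
       + of_bool (r = \<sigma> (mate c s)) else of_bool (r = \<sigma> s))"
  using assms by (auto simp: clan_vec_mat_def clan_vec_def plus_set_def unit_vec_def)

text \<open>By admissibility, \<theta> fixes the unit vector of a + position and negates that of a -
  position. It therefore exchanges the two clan vectors of a matching pair and multiplies the vector
  at a sign by that sign.\<close>

lemma sign_mat_mult_clan_vec_mat:
  assumes c: "matched c" "length c = p + q" and adm: "admissible p q c \<sigma>"
  shows "sign_mat (p + q) {..<p} * clan_vec_mat (p + q) c \<sigma> = clan_vec_mat (p + q) c \<sigma> * clan_mat c"
proof (rule eq_matI)
  let ?n = "p + q" and ?V = "clan_vec_mat (p + q) c \<sigma>"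
  have Mc: "clan_mat c \<in> carrier_mat ?n ?n"
    using clan_mat_carrier[of c] c by simp
  have plus: "\<sigma> i < p \<longleftrightarrow> i \<in> plus_set c" if "i < ?n" for i
    using adm admissible_iff[OF c(2)] that by auto
  fix r s assume "r < dim_row (?V * clan_mat c)" "s < dim_col (?V * clan_mat c)"
  then have r: "r < ?n" and s: "s < ?n"
    using Mc by (auto simp: clan_vec_mat_def)
  note V = clan_vec_mat_entry[OF r _ c(2)] and Vc = clan_vec_mat_carrier[of ?n c \<sigma>]
  have theta: "(sign_mat ?n {..<p} * ?V) $$ (r, s) = (if r < p then ?V $$ (r, s) else - ?V $$ (r, s))"
    using sign_mat_mult_entry(1)[OF Vc r s] by simp
  show "(sign_mat ?n {..<p} * ?V) $$ (r, s) = (?V * clan_mat c) $$ (r, s)"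
  proof (cases "is_label (c ! s)")
    case True
    have s': "s < length c" using s c by simp
    note m = mate_props(1,2,3,5)[OF c(1) s' True]
    have "?V $$ (r, t) * clan_mat c $$ (t, s) = (if t = mate c s then ?V $$ (r, mate c s) else 0)" if "t < ?n" for t
      using that s c True by (auto simp: clan_mat_def)
    then have "(?V * clan_mat c) $$ (r, s) = ?V $$ (r, mate c s)"
      using m(1) c(2) by (simp add: mult_mat_entry[OF Vc Mc r s])
    then show ?thesis
      unfolding theta using V[OF s, of \<sigma>] V[of "mate c s" \<sigma>] m c(2) True plus[OF s] plus[of "mate c s"]
        plus_set_mate[OF c(1) s' True]
      by auto
  next
    case False
    have "?V $$ (r, t) * clan_mat c $$ (t, s) =
        (if t = s then (if c ! s = PlusSign then ?V $$ (r, s) else - ?V $$ (r, s)) else 0)" if "t < ?n" for t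
      using that s c False by (auto simp: clan_mat_def)
    then have "(?V * clan_mat c) $$ (r, s) = (if c ! s = PlusSign then ?V $$ (r, s) else - ?V $$ (r, s))"
      using s by (simp add: mult_mat_entry[OF Vc Mc r s])
    then show ?thesis
      unfolding theta using V[OF s, of \<sigma>] False plus[OF s] plus_set_sign[of s c] s c(2)
      by auto
  qed
qed (use c clan_mat_carrier[of c] in \<open>auto simp: clan_vec_mat_def sign_mat_def\<close>)

text \<open>For \<open>x\<close> in the kernel, row \<open>\<sigma> k\<close> involves only
  \<open>x $ k\<close> and the entry at the mate of \<open>k\<close>. The two rows of a pair say
  that these entries have sum zero and difference zero.\<close>

lemma det_clan_vec_mat:
  assumes c: "matched c" "length c = n" and \<sigma>: "\<sigma> permutes {0..<n}"
  shows "det (clan_vec_mat n c \<sigma>) \<noteq> 0"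
proof
  let ?V = "clan_vec_mat n c \<sigma>"
  note Vc = clan_vec_mat_carrier[of n c \<sigma>]
  assume "det ?V = 0"
  then obtain x where x: "x \<in> carrier_vec n" "x \<noteq> 0\<^sub>v n" "?V *\<^sub>v x = 0\<^sub>v n"
    using det_0_iff_vec_prod_zero_field[OF Vc] by auto
  have inj: "\<sigma> i = \<sigma> j \<longleftrightarrow> i = j" for i j
    using permutes_inj[OF \<sigma>] by (simp add: inj_eq)
  have lt: "\<sigma> i < n" if "i < n" for i
    using permutes_in_image[OF \<sigma>, of i] that by simp
  have zero: "(\<Sum>s<n. ?V $$ (\<sigma> k, s) * x $ s) = 0" if "k < n" for k
    using mult_vec_entry[OF Vc x(1) lt[OF that]] x(3) lt[OF that] by simp
  have V: "?V $$ (\<sigma> k, s) = (if s = k then (if is_label (c ! k) \<and> k \<notin> plus_set c then - 1 else 1) else 0)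
      + of_bool (is_label (c ! k) \<and> s = mate c k)" if "k < n" "s < n" for k s
    using clan_vec_mat_entry[OF lt[OF that(1)] that(2) c(2), of \<sigma>] that c(2)
      mate_props(2,3,5)[OF c(1), of s] mate_props(2,3,5)[OF c(1), of k]
    by (auto simp: inj)
  have row: "(if is_label (c ! k) \<and> k \<notin> plus_set c then - x $ k else x $ k) +
      (if is_label (c ! k) then x $ mate c k else 0) = 0" if k: "k < n" for k
  proof -
    have "?V $$ (\<sigma> k, s) * x $ s =
        (if s = k then (if is_label (c ! k) \<and> k \<notin> plus_set c then - x $ k else x $ k) else 0) +
        (if s = mate c k then (if is_label (c ! k) then x $ mate c k else 0) else 0)" if "s < n" for s
      using V[OF k that] mate_props(2)[OF c(1), of k] k c(2) by auto
    then show ?thesis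
      using zero[OF k] k mate_props(1)[OF c(1), of k] c(2)
      by (auto simp: sum.distrib split: if_splits)
  qed
  have "x $ k = 0" if k: "k < n" for k
  proof (cases "is_label (c ! k)")
    case True
    note m = mate_props(1,2,3,5)[OF c(1) _ True]
    show ?thesis
      using row[OF k] row[of "mate c k"] m plus_set_mate[OF c(1) _ True] k True c(2)
      by (auto simp: add_eq_0_iff2 split: if_splits)
  next
    case False
    then show ?thesis
      using row[OF k] by auto
  qed
  then show False
    using x(1,2) by auto
qed

text \<open>Each \<open>i\<close> in \<open>D\<close> is matched with \<open>f i\<close>, using the
  position \<open>i\<close> itself as label, so that different pairs get different labels. A pair
  takes one + from \<open>J\<close> and one - from the complement, hence the difference of the sign
  counts remains \<open>p - q\<close>. As \<open>i < f i\<close>, the default signature at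
  \<open>f i\<close> is +, and the base clan is the one of \<open>J\<close>.\<close>

lemma clan_of_matching:
  assumes J: "J \<subseteq> {..<p + q}" "card J = p" and D: "D \<subseteq> {..<p + q} - J" "inj_on f D"
    and f: "\<And>i. i \<in> D \<Longrightarrow> f i \<in> J" "\<And>i. i \<in> D \<Longrightarrow> i < f i"
  obtains c where "c \<in> clan_seqs p q" "plus_set c = J"
    "pair_mat c = mat (p + q) (p + q) (\<lambda>(r, s). of_bool (s \<in> D \<and> r = f s))"
proof -
  let ?n = "p + q"
  define c where "c = map (\<lambda>k. if k \<in> D then Label k
    else if k \<in> f ` D then Label (the_inv_into D f k)
    else if k \<in> J then PlusSign else MinusSign) [0..<?n]"
  have len: "length c = ?n" by (simp add: c_def)
  have lt: "i < ?n" "f i < ?n" "f i \<notin> D" "i \<notin> f ` D" if "i \<in> D" for i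
    using that D J f by auto
  have nth: "c ! k = (if k \<in> D then Label k
    else if k \<in> f ` D then Label (the_inv_into D f k)
    else if k \<in> J then PlusSign else MinusSign)" if "k < ?n" for k
    using that by (simp add: c_def)
  have lab: "c ! k = Label a \<longleftrightarrow> a \<in> D \<and> (k = a \<or> k = f a)" if "k < ?n" for k a
    using nth[OF that] lt D(2) by (auto simp: the_inv_into_f_f)
  have count: "count_list c (Label a) = 2" if "a \<in> D" for a
  proof -
    have "{k. k < length c \<and> c ! k = Label a} = {a, f a}"
      using lab lt that len by auto
    then show ?thesis
      using f(2)[OF that] by (simp add: count_list_card)
  qed
  have matched: "matched c"
    unfolding matched_def using count lab len by (metis in_set_conv_nth)
  have fin: "finite J" "finite D"
    using finite_subset[OF J(1)] finite_subset[OF D(1)] by auto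
  have JD: "x < ?n" "x \<notin> D" if "x \<in> J" for x
    using that J(1) D(1) by auto
  have DD: "x < ?n" "x \<notin> J" if "x \<in> D" for x
    using that D(1) by auto
  have fJ: "x \<in> J" if "x \<in> f ` D" for x
    using that f(1) by auto
  have plus: "{k. k < length c \<and> c ! k = PlusSign} = J - f ` D"
  proof (rule Set.set_eqI)
    fix k show "k \<in> {k. k < length c \<and> c ! k = PlusSign} \<longleftrightarrow> k \<in> J - f ` D"
      using nth[of k] JD[of k] len
      by (cases "k \<in> D"; cases "k \<in> f ` D"; cases "k \<in> J"; cases "k < ?n") simp_all
  qed
  have minus: "{k. k < length c \<and> c ! k = MinusSign} = {..<?n} - J - D"
  proof (rule Set.set_eqI)
    fix k show "k \<in> {k. k < length c \<and> c ! k = MinusSign} \<longleftrightarrow> k \<in> {..<?n} - J - D"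
      using nth[of k] fJ[of k] len
      by (cases "k \<in> D"; cases "k \<in> f ` D"; cases "k \<in> J"; cases "k < ?n") simp_all
  qed
  have "card (f ` D) = card D"
    using D(2) by (rule card_image)
  \<comment> \<open>These bounds make the subtractions \<open>p - card D\<close> and
    \<open>q - card D\<close> of natural numbers exact.\<close>
  moreover have "card D \<le> p" "card D \<le> q"
  proof -
    have "f ` D \<subseteq> J" using f by auto
    then show "card D \<le> p"
      using card_mono[OF fin(1)] \<open>card (f ` D) = card D\<close> J(2) by metis
    have "card ({..<?n} - J) = q"
      using J fin by (simp add: card_Diff_subset)
    then show "card D \<le> q"
      using card_mono[OF _ D(1)] by simp
  qed
  moreover have "card (J - f ` D) = p - card (f ` D)"
    using f fin J by (subst card_Diff_subset) auto
  moreover have "card ({..<?n} - J - D) = q - card D"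
    using D fin J by (subst card_Diff_subset) (auto simp: card_Diff_subset)
  ultimately have "int (count_list c PlusSign) - int (count_list c MinusSign) = int p - int q"
    unfolding count_list_card plus minus by simp
  then have seq: "c \<in> clan_seqs p q"
    using len matched by (simp add: clan_seqs_def matched_def)
  have mate: "mate c i = f i" if "i \<in> D" for i
  proof (rule mate_props(4)[OF matched])
    have "c ! i = Label i" "c ! f i = Label i"
      using lab lt(1,2)[OF that] that by auto
    then show "is_label (c ! i)" "c ! f i = c ! i"
      by auto
    show "i < length c" "f i < length c" "f i \<noteq> i"
      using lt(1,2)[OF that] len f(2)[OF that] by auto
  qed
  have ps: "plus_set c = J"
  proof (rule Set.set_eqI)
    fix k
    consider "\<not> k < ?n" | "k \<in> D" | a where "a \<in> D" "k = f a" | "k < ?n" "k \<notin> D" "k \<notin> f ` D" by blast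
    then show "k \<in> plus_set c \<longleftrightarrow> k \<in> J"
    proof cases
      case 1
      then show ?thesis using J len by (auto simp: plus_set_def)
    next
      case 2
      \<comment> \<open>The only other occurrence of the label \<open>k\<close> is at
        \<open>f k\<close>, to the right of \<open>k\<close>.\<close>
      then have "\<not> (\<exists>j<k. c ! j = Label k)"
        using lab lt f(2) by (metis less_imp_not_less less_irrefl less_trans)
      then show ?thesis
        using 2 nth[of k] lt[OF 2] D by (auto simp: plus_set_def default_sign_def)
    next
      case 3
      then have "c ! k = Label a" "\<exists>j<k. c ! j = Label a"
        using lab lt f(2) by blast+
      then show ?thesis
        using 3 lt(2)[OF 3(1)] f(1)[OF 3(1)] len by (auto simp: plus_set_def default_sign_def)
    next
      case 4
      then show ?thesis
        using nth[of k] len by (auto simp: plus_set_def default_sign_def)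
    qed
  qed
  have "pair_mat c = mat ?n ?n (\<lambda>(r, s). of_bool (s \<in> D \<and> r = f s))"
  proof (rule eq_matI)
    fix r s assume "r < dim_row (mat ?n ?n (\<lambda>(r, s). of_bool (s \<in> D \<and> r = f s)))"
      "s < dim_col (mat ?n ?n (\<lambda>(r, s). of_bool (s \<in> D \<and> r = f s)))"
    then have rs: "r < ?n" "s < ?n" by auto
    have "is_label (c ! s) \<and> s \<notin> J \<longleftrightarrow> s \<in> D"
      using nth[OF rs(2)] f D rs by auto
    then show "pair_mat c $$ (r, s) = mat ?n ?n (\<lambda>(r, s). of_bool (s \<in> D \<and> r = f s)) $$ (r, s)"
      using rs mate len ps by (auto simp: pair_mat_def)
  qed (simp_all add: pair_mat_def len)
  with seq ps that show ?thesis by blast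
qed

text \<open>Three conjugations are composed: \<open>l\<close> turns \<open>N\<close> into a partial
  permutation matrix \<open>P\<close>, then \<open>T\<close> removes the entries of \<open>P\<close>
  above the diagonal, and finally \<open>U\<close> passes from the remaining pairs to the clan
  matrix.\<close>

lemma sign_mat_plus_block_strict_normal_form:
  fixes N :: "complex mat"
  assumes J: "J \<subseteq> {..<p + q}" "card J = p" and N: "block_strict (p + q) J N"
  obtains c T where "c \<in> clan_seqs p q" "plus_set c = J" "T \<in> borel_GL (p + q)"
    "T * (sign_mat (p + q) J + N) = clan_mat c * T"
proof -
  let ?n = "p + q"
  let ?S = "sign_mat ?n J :: complex mat"
  obtain l P where l: "l \<in> borel_GL ?n" "block_diag ?n J l" and P: "block_strict ?n J P" "rows_reduced ?n 0 P"
    and lP: "l * N = P * l"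
    using reduce_rows[OF N] by metis
  have Pc: "P \<in> carrier_mat ?n ?n" and Nc: "N \<in> carrier_mat ?n ?n"
    using P(1) N by (auto simp: block_strict_def)
  note lc = borel_GLD(1)[OF l(1)] and Sc = sign_mat_carrier[of ?n J]
  have Ps: "P $$ (i, j) = 0" if "i < ?n" "j < ?n" "i \<notin> J \<or> j \<in> J" for i j
    using P(1) that unfolding block_strict_def by blast
  have Pr: "P $$ (i, j) = 1" "\<And>j'. j' < ?n \<Longrightarrow> j' \<noteq> j \<Longrightarrow> P $$ (i, j') = 0"
      "\<And>i'. i' < ?n \<Longrightarrow> i' \<noteq> i \<Longrightarrow> P $$ (i', j) = 0"
    if "i < ?n" "j < ?n" "P $$ (i, j) \<noteq> 0" for i j
    using P(2) that unfolding rows_reduced_def by blast+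
  have "?S * l = l * ?S"
    unfolding sign_mat_commute_iff[OF lc] using l(2) unfolding block_diag_def by blast
  then have 1: "l * (?S + N) = (?S + P) * l"
    using lP by (simp add: mult_add_distrib_mat[OF lc Sc Nc] add_mult_distrib_mat[OF Sc Pc lc])
  \<comment> \<open>The entries of \<open>P\<close> below the diagonal become the matching pairs:
    \<open>D\<close> holds their columns, the future first positions, and \<open>f\<close> their
    rows. The row condition of \<open>rows_reduced\<close> makes \<open>f\<close> injective.\<close>
  define D where "D = {i. i < ?n \<and> (\<exists>j<?n. i < j \<and> P $$ (j, i) \<noteq> 0)}"
  define f where "f = (\<lambda>i. SOME j. j < ?n \<and> i < j \<and> P $$ (j, i) \<noteq> 0)"
  have fD: "f i < ?n" "i < f i" "P $$ (f i, i) \<noteq> 0" if "i \<in> D" for i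
    using that someI_ex[of "\<lambda>j. j < ?n \<and> i < j \<and> P $$ (j, i) \<noteq> 0"] unfolding D_def f_def by auto
  have Dn: "i < ?n" if "i \<in> D" for i
    using that by (simp add: D_def)
  have fJ: "f i \<in> J" and Dm: "i \<notin> J" if "i \<in> D" for i
    using fD[OF that] Ps[of "f i" i] Dn[OF that] by auto
  have inj: "inj_on f D"
  proof (rule inj_onI)
    fix i i' assume i: "i \<in> D" "i' \<in> D" "f i = f i'"
    then have "P $$ (f i, i) \<noteq> 0" "P $$ (f i, i') \<noteq> 0" "i < ?n" "i' < ?n"
      using fD(3)[OF i(1)] fD(3)[OF i(2)] Dn[OF i(1)] Dn[OF i(2)] by simp_all
    then show "i = i'"
      using Pr(2)[of "f i" i i'] fD(1)[OF i(1)] by auto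
  qed
  have DJ: "D \<subseteq> {..<?n} - J"
    using Dn Dm by auto
  obtain c where c: "c \<in> clan_seqs p q" "plus_set c = J"
    "pair_mat c = mat ?n ?n (\<lambda>(r, s). of_bool (s \<in> D \<and> r = f s))"
    using clan_of_matching[OF J DJ inj fJ fD(2)] by blast
  define P' where "P' = pair_mat c"
  have P'c: "P' \<in> carrier_mat ?n ?n"
    by (simp add: P'_def c(3))
  \<comment> \<open>By the column condition \<open>P\<close> has no second entry in column
    \<open>s\<close>, so the pairs account for everything below the diagonal.\<close>
  have P': "P' $$ (r, s) = (if s < r then P $$ (r, s) else 0)" if "r < ?n" "s < ?n" for r s
  proof (cases "s \<in> D \<and> r = f s")
    case True
    then show ?thesis
      using fD[of s] Pr(1)[of r s] that by (auto simp: P'_def c(3))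
  next
    case False
    have "P $$ (r, s) = 0" if "s < r"
    proof (rule ccontr)
      assume *: "P $$ (r, s) \<noteq> 0"
      then have "s \<in> D"
        using \<open>r < ?n\<close> \<open>s < ?n\<close> that by (auto simp: D_def)
      then show False
        using Pr(3)[of "f s" s r] fD[of s] * False \<open>r < ?n\<close> \<open>s < ?n\<close> by auto
    qed
    with False show ?thesis
      using that by (auto simp: P'_def c(3))
  qed
  \<comment> \<open>Let X be the part of \<open>P\<close> above the diagonal, so \<open>T\<close> is
    1 + X/2. Since \<open>?S\<close> X = X = - X \<open>?S\<close> and X \<open>P\<close> =
    \<open>P'\<close> X = 0, the two sides of \<open>2\<close> are \<open>?S + P\<close> - X/2 and
    \<open>?S + P'\<close> + X/2, which agree because \<open>P\<close> = \<open>P'\<close> +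
    X.\<close>
  define T where "T = mat ?n ?n (\<lambda>(r, s). of_bool (r = s) + (if r < s then P $$ (r, s) / 2 else 0))"
  have Tc: "T \<in> carrier_mat ?n ?n"
    by (simp add: T_def)
  have T: "T \<in> borel_GL ?n"
    by (rule borel_GLI) (auto simp: T_def)
  have 2: "T * (?S + P) = (?S + P') * T"
  proof (rule eq_matI)
    fix r s assume "r < dim_row ((?S + P') * T)" "s < dim_col ((?S + P') * T)"
    then have r: "r < ?n" and s: "s < ?n"
      using P'c Tc by auto
    have Spc: "?S + P \<in> carrier_mat ?n ?n" "?S + P' \<in> carrier_mat ?n ?n"
      using Pc P'c by auto
    have S: "?S $$ (i, j) = (if i = j then (if i \<in> J then 1 else - 1) else 0)" if "i < ?n" "j < ?n" for i j
      using that by (simp add: sign_mat_def)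
    define h where "h = P $$ (r, s) / 2"
    have half: "P $$ (r, s) = h + h"
      by (simp add: h_def)
    have "T $$ (r, t) * (?S + P) $$ (t, s) = (if t = r then (?S + P) $$ (r, s) else 0) +
        (if t = s then (if r < s then - h else 0) else 0)" if "t < ?n" for t
      using that r s Ps[of r t] Ps[of t s] Pc by (cases "t \<in> J") (auto simp: T_def S h_def)
    then have "(T * (?S + P)) $$ (r, s) = (?S + P) $$ (r, s) + (if r < s then - h else 0)"
      using r s by (simp add: mult_mat_entry[OF Tc Spc(1) r s] sum.distrib)
    moreover have "(?S + P') $$ (r, t) * T $$ (t, s) = (if t = s then (?S + P') $$ (r, s) else 0) +
        (if t = r then (if r < s then h else 0) else 0)" if "t < ?n" for t
      using that r s Ps[of r t] Ps[of t s] P'c P' by (cases "t \<in> J") (auto simp: T_def S h_def)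
    then have "((?S + P') * T) $$ (r, s) = (?S + P') $$ (r, s) + (if r < s then h else 0)"
      using r s by (simp add: mult_mat_entry[OF Spc(2) Tc r s] sum.distrib)
    moreover have "P $$ (r, s) = 0" if "r = s"
      using Ps[OF r s] that by auto
    ultimately show "(T * (?S + P)) $$ (r, s) = ((?S + P') * T) $$ (r, s)"
      using r s Pc P'c P'[OF r s] half by (cases r s rule: linorder_cases) auto
  qed (use Tc Pc P'c in auto)
  obtain U where U: "U \<in> borel_GL ?n" "U * (?S + P') = clan_mat c * U"
    using clan_mat_conj_sign_plus_pair[of c] clan_seqsD[OF c(1)] c(2) unfolding P'_def by metis
  note Uc = borel_GLD(1)[OF U(1)]
  have Mc: "clan_mat c \<in> carrier_mat ?n ?n"
    using clan_mat_carrier[of c] clan_seqsD[OF c(1)] by simp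
  have Ac: "?S + N \<in> carrier_mat ?n ?n" "?S + P \<in> carrier_mat ?n ?n" "?S + P' \<in> carrier_mat ?n ?n"
    using Nc Pc P'c by auto
  have "(U * T * l) * (?S + N) = U * (T * (l * (?S + N)))"
    using Uc Tc lc Ac by (simp add: assoc_mult_mat[of _ ?n ?n _ ?n _ ?n])
  also have "\<dots> = U * ((T * (?S + P)) * l)"
    unfolding 1 using Tc lc Ac by (simp add: assoc_mult_mat[of _ ?n ?n _ ?n _ ?n])
  also have "\<dots> = (U * (?S + P')) * (T * l)"
    unfolding 2 using Uc Tc lc Ac by (simp add: assoc_mult_mat[of _ ?n ?n _ ?n _ ?n])
  also have "\<dots> = clan_mat c * (U * T * l)"
    unfolding U(2) using Uc Tc lc Mc by (simp add: assoc_mult_mat[of _ ?n ?n _ ?n _ ?n])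
  finally show ?thesis
    using that c(1,2) borel_GL_mult[OF borel_GL_mult[OF U(1) T] l(1)] by blast
qed

subsection \<open>Orbits and the sect decomposition\<close>

lemma relabelling_equiv: "equiv UNIV relabelling"
proof (rule equivI)
  show "refl relabelling"
    by (auto simp: relabelling_def refl_on_def)
  show "sym relabelling"
    by (auto simp: relabelling_def sym_def)
  show "trans relabelling"
    by (auto simp: relabelling_def trans_def)
qed auto

lemma clan_of_eq_iff: "clan_of c = clan_of d \<longleftrightarrow> (c, d) \<in> relabelling"
  unfolding clan_of_def by (rule equiv_class_eq_iff[OF relabelling_equiv, simplified, symmetric])

text \<open>Everything that enters the orbit and the base clan is constant on a clan, which gives
  \<open>on_class\<close> its meaning there.\<close>

lemma relabelling_signs:
  assumes "(c, d) \<in> relabelling" "i < length c"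
  shows "default_sign d i = default_sign c i" "mate d i = mate c i"
    and "d ! i = PlusSign \<longleftrightarrow> c ! i = PlusSign" "d ! i = MinusSign \<longleftrightarrow> c ! i = MinusSign"
proof -
  have len: "length d = length c" and eq: "\<And>j. j < length c \<Longrightarrow> d ! j = d ! i \<longleftrightarrow> c ! j = c ! i"
    using assms by (auto simp: relabelling_def)
  show signs: "d ! i = PlusSign \<longleftrightarrow> c ! i = PlusSign" "d ! i = MinusSign \<longleftrightarrow> c ! i = MinusSign"
    using assms by (auto simp: relabelling_def)
  have "(\<exists>j<i. d ! j = d ! i) \<longleftrightarrow> (\<exists>j<i. c ! j = c ! i)"
    using eq assms(2) by (metis less_trans)
  then show "default_sign d i = default_sign c i"
    using signs by (cases "c ! i"; cases "d ! i") (auto simp: default_sign_def)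
  have "(\<lambda>j. j < length d \<and> j \<noteq> i \<and> d ! j = d ! i) = (\<lambda>j. j < length c \<and> j \<noteq> i \<and> c ! j = c ! i)"
    using eq len by auto
  then show "mate d i = mate c i"
    by (simp add: mate_def)
qed

text \<open>The two predicates \<open>admissible p q c\<close> and \<open>admissible p q d\<close>
  are equal, so \<open>SOME\<close> returns the same \<sigma> for both, and for it the clan vectors
  agree.\<close>

lemma orbit_Q_seq_relabelling:
  assumes "(c, d) \<in> relabelling" "length c = p + q"
  shows "orbit_Q_seq p q d = orbit_Q_seq p q c"
proof -
  have "admissible p q d = admissible p q c"
    using relabelling_signs[OF assms(1)] assms(2) by (auto simp: admissible_def fun_eq_iff)
  moreover have "map (clan_vec (p + q) d \<sigma>) [0..<p + q] = map (clan_vec (p + q) c \<sigma>) [0..<p + q]" for \<sigma>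
    using relabelling_signs[OF assms(1)] assms(2) by (auto simp: clan_vec_def)
  ultimately show ?thesis
    by (simp only: orbit_Q_seq_def Let_def)
qed

lemma clan_of_self: "c \<in> clan_of c"
  by (simp add: clan_of_def relabelling_def)

lemma orbit_Q_clan_of:
  assumes "c \<in> clan_seqs p q"
  shows "orbit_Q p q (clan_of c) = orbit_Q_seq p q c"
  unfolding orbit_Q_def
  by (rule on_class_eq[OF clan_of_self])
    (use orbit_Q_seq_relabelling clan_seqsD[OF assms] in \<open>auto simp: clan_of_def\<close>)

lemma base_clan_clan_of: "base_clan (clan_of c) = clan_of (base_seq c)"
  unfolding base_clan_def
proof (rule on_class_eq[OF clan_of_self])
  fix d assume "d \<in> clan_of c"
  then have rel: "(c, d) \<in> relabelling"
    by (simp add: clan_of_def)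
  then have "length d = length c"
    by (simp add: relabelling_def)
  then have "base_seq d = base_seq c"
    using relabelling_signs(1)[OF rel] by (simp add: base_seq_def)
  then show "clan_of (base_seq d) = clan_of (base_seq c)"
    by simp
qed

lemma default_sign_cases: "default_sign c i = PlusSign \<or> default_sign c i = MinusSign"
  by (auto simp: default_sign_def split: clan_symbol.splits)

text \<open>Sequences without labels are relabellings of each other only if they are equal, and a
  sequence of signs is determined by its + positions.\<close>

lemma base_clan_eq_iff:
  assumes "length c = n"
  shows "base_clan (clan_of c) = clan_of_subset n I \<longleftrightarrow> plus_set c = {i. i < n \<and> unit_vec n i \<in> I}"
proof -
  define d where "d = map (\<lambda>i. if unit_vec n i \<in> I then PlusSign else MinusSign) [0..<n]"
  have d: "length d = n" "\<And>i. i < n \<Longrightarrow> d ! i = (if unit_vec n i \<in> I then PlusSign else MinusSign)"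
    by (simp_all add: d_def)
  have b: "length (base_seq c) = n" "\<And>i. i < n \<Longrightarrow> base_seq c ! i = default_sign c i"
    using assms by (simp_all add: base_seq_def)
  have "base_clan (clan_of c) = clan_of_subset n I \<longleftrightarrow> (base_seq c, d) \<in> relabelling"
    by (simp add: base_clan_clan_of clan_of_subset_def clan_of_eq_iff d_def)
  also have "\<dots> \<longleftrightarrow> (\<forall>i<n. base_seq c ! i = PlusSign \<longleftrightarrow> d ! i = PlusSign)"
  proof
    assume *: "\<forall>i<n. base_seq c ! i = PlusSign \<longleftrightarrow> d ! i = PlusSign"
    have "base_seq c ! i = d ! i" if "i < n" for i
      using * d(2)[OF that] b(2)[OF that] default_sign_cases[of c i] that by (auto split: if_splits)
    then have "base_seq c = d"
      using b(1) d(1) by (intro nth_equalityI) auto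
    then show "(base_seq c, d) \<in> relabelling"
      by (simp add: relabelling_def)
  qed (use b in \<open>auto simp: relabelling_def\<close>)
  also have "\<dots> \<longleftrightarrow> plus_set c = {i. i < n \<and> unit_vec n i \<in> I}"
    using d(2) b(2) assms by (auto simp: plus_set_def split: if_splits)
  finally show ?thesis .
qed

lemma sect_clan_of_subset:
  "sect p q (clan_of_subset (p + q) I) =
    clan_of ` {c \<in> clan_seqs p q. plus_set c = {i. i < p + q \<and> unit_vec (p + q) i \<in> I}}"
proof -
  have clans: "clans p q = clan_of ` clan_seqs p q"
    by (auto simp: clans_def quotient_def clan_of_def)
  have base: "base_clan (clan_of c) = clan_of_subset (p + q) I \<longleftrightarrow>
      plus_set c = {i. i < p + q \<and> unit_vec (p + q) i \<in> I}" if "c \<in> clan_seqs p q" for c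
    by (rule base_clan_eq_iff[OF clan_seqsD(1)[OF that]])
  have "{\<gamma> \<in> clan_of ` S. Q \<gamma>} = clan_of ` {c \<in> S. Q (clan_of c)}" for S Q
    by blast
  then show ?thesis
    unfolding sect_def clans by (simp only: base cong: conj_cong)
qed

section \<open>Orbits and the Schubert cell as conjugacy conditions on involutions\<close>

lemma mult_left_cancel_mat:
  fixes A :: "'a::field mat"
  assumes "A \<in> carrier_mat n n" "det A \<noteq> 0" "B \<in> carrier_mat n n" "C \<in> carrier_mat n n" "A * B = A * C"
  shows "B = C"
proof -
  obtain A' where A': "A' \<in> carrier_mat n n" "A' * A = 1\<^sub>m n"
    using obtain_inverse_mat[OF assms(1,2)] by metis
  have "A' * A * B = A' * A * C"
    using assms(1,3-5) A'(1) by (simp add: assoc_mult_mat[of _ n n _ n _ n])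
  then show ?thesis
    using A'(2) assms(3,4) by simp
qed

text \<open>The right side says that \<open>T\<close> conjugates the involution of \<open>g\<close>
  to \<open>clan_mat c\<close>. If the flags of \<open>g\<close> and \<open>l * V\<close> agree,
  then \<open>l * V = g * T\<close> with \<open>T\<close> triangular, and \<open>l\<close> commutes
  with \<theta>. Conversely, \<open>g * T\<close> times the inverse of \<open>V\<close> commutes
  with \<theta> and lies in L after scaling.\<close>

lemma coset_in_orbit_Q_seq_iff:
  assumes c: "c \<in> clan_seqs p q" "card (plus_set c) = p" and pq: "p + q > 0"
    and g: "g \<in> carrier (SL (p + q))"
  shows "g <#\<^bsub>SL (p + q)\<^esub> borel_SL (p + q) \<in> orbit_Q_seq p q c \<longleftrightarrow>
    (\<exists>T\<in>borel_GL (p + q). sign_mat (p + q) {..<p} * (g * T) = (g * T) * clan_mat c)"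
proof -
  let ?n = "p + q" and ?t = "sign_mat (p + q) {..<p} :: complex mat"
  define \<sigma> where "\<sigma> = (SOME \<sigma>. admissible p q c \<sigma>)"
  have adm: "admissible p q c \<sigma>"
    unfolding \<sigma>_def using admissible_exists[OF clan_seqsD(1)[OF c(1)] c(2)] by (rule someI_ex)
  then have perm: "\<sigma> permutes {0..<?n}"
    by (simp add: admissible_def)
  define V where "V = clan_vec_mat ?n c \<sigma>"
  have Vc: "V \<in> carrier_mat ?n ?n" and dV: "det V \<noteq> 0"
    using clan_vec_mat_carrier det_clan_vec_mat[OF clan_seqsD(2,1)[OF c(1)] perm] by (auto simp: V_def)
  have tV: "?t * V = V * clan_mat c"
    unfolding V_def by (rule sign_mat_mult_clan_vec_mat[OF clan_seqsD(2,1)[OF c(1)] adm])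
  have gc: "g \<in> carrier_mat ?n ?n" "det g \<noteq> 0"
    using g by (auto simp: carrier_SL_iff)
  have Mc: "clan_mat c \<in> carrier_mat ?n ?n"
    using clan_mat_carrier[of c] clan_seqsD[OF c(1)] by simp
  note tc = sign_mat_carrier[of ?n "{..<p}"]
  have "g <#\<^bsub>SL ?n\<^esub> borel_SL ?n \<in> orbit_Q_seq p q c \<longleftrightarrow>
      (\<exists>l\<in>levi_SL p q. flag ?n (cols g) = act_flag l (flag ?n (cols V)))"
    using g by (auto simp: orbit_Q_seq_def Let_def flag_of_coset_borel LCOSETS_def V_def \<sigma>_def
        cols_clan_vec_mat)
  also have "\<dots> \<longleftrightarrow> (\<exists>l\<in>levi_SL p q. flag ?n (cols g) = flag ?n (cols (l * V)))"
    using act_flag_cols[OF _ Vc] by (auto simp: levi_SL_iff)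
  also have "\<dots> \<longleftrightarrow> (\<exists>T\<in>borel_GL ?n. ?t * (g * T) = (g * T) * clan_mat c)"
  proof
    assume "\<exists>l\<in>levi_SL p q. flag ?n (cols g) = flag ?n (cols (l * V))"
    then obtain l where l: "l \<in> carrier_mat ?n ?n" "det l = 1" "?t * l = l * ?t"
      and eq: "flag ?n (cols (l * V)) = flag ?n (cols g)"
      by (auto simp: levi_SL_iff)
    have lV: "l * V \<in> carrier_mat ?n ?n" "det (l * V) \<noteq> 0"
      using l Vc dV by (auto simp: det_mult[OF l(1) Vc])
    obtain T where T: "T \<in> borel_GL ?n" "l * V = g * T"
      using flag_cols_eqD[OF lV gc eq] by blast
    have "?t * (l * V) = (?t * l) * V"
      using assoc_mult_mat[OF tc l(1) Vc] by simp
    also have "\<dots> = l * (?t * V)"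
      unfolding l(3) by (rule assoc_mult_mat[OF l(1) tc Vc])
    also have "\<dots> = (l * V) * clan_mat c"
      unfolding tV using assoc_mult_mat[OF l(1) Vc Mc] by simp
    finally show "\<exists>T\<in>borel_GL ?n. ?t * (g * T) = (g * T) * clan_mat c"
      using T by auto
  next
    assume "\<exists>T\<in>borel_GL ?n. ?t * (g * T) = (g * T) * clan_mat c"
    then obtain T where T: "T \<in> borel_GL ?n" "?t * (g * T) = (g * T) * clan_mat c" by blast
    note Tc = borel_GLD(1)[OF T(1)]
    obtain W where W: "W \<in> carrier_mat ?n ?n" "V * W = 1\<^sub>m ?n" "W * V = 1\<^sub>m ?n" "det W \<noteq> 0"
      using obtain_inverse_mat[OF Vc dV] .
    define k where "k = g * T * W"
    have gT: "g * T \<in> carrier_mat ?n ?n" and kc: "k \<in> carrier_mat ?n ?n"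
      using gc Tc W by (auto simp: k_def)
    have kV: "k * V = g * T"
      unfolding k_def assoc_mult_mat[OF gT W(1) Vc] W(3) by (rule right_mult_one_mat[OF gT])
    have "(?t * k) * V = ?t * (g * T)"
      unfolding assoc_mult_mat[OF tc kc Vc] kV ..
    also have "\<dots> = k * (?t * V)"
      unfolding T(2) tV using assoc_mult_mat[OF kc Vc Mc] kV by simp
    also have "\<dots> = (k * ?t) * V"
      using assoc_mult_mat[OF kc tc Vc] by simp
    finally have "(?t * k) * V * W = (k * ?t) * V * W" by simp
    then have tk: "?t * k = k * ?t"
      unfolding assoc_mult_mat[OF mult_carrier_mat[OF tc kc] Vc W(1)]
        assoc_mult_mat[OF mult_carrier_mat[OF kc tc] Vc W(1)] W(2)
      using right_mult_one_mat[OF mult_carrier_mat[OF tc kc]] right_mult_one_mat[OF mult_carrier_mat[OF kc tc]] by simp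
    have "det k \<noteq> 0"
      unfolding k_def det_mult[OF gT W(1)] det_mult[OF gc(1) Tc] using gc borel_GLD(3)[OF T(1)] W by simp
    \<comment> \<open>The scalar brings \<open>k\<close> to determinant 1; on the other side it is
      absorbed by \<open>T\<close>, where it does not affect the flag.\<close>
    from exists_root_inverse[OF this pq] obtain a where a: "a \<noteq> 0" "a ^ ?n * det k = 1" .
    define l where "l = a \<cdot>\<^sub>m k"
    have lc: "l \<in> carrier_mat ?n ?n"
      using kc by (simp add: l_def)
    have "?t * l = l * ?t"
      unfolding l_def using mult_smult_distrib[OF tc kc] mult_smult_assoc_mat[OF kc tc] tk by simp
    moreover have "det l = 1"
      using a kc by (simp add: l_def det_smult)
    ultimately have l: "l \<in> levi_SL p q"
      using lc by (simp add: levi_SL_iff)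
    have "l * V = g * (a \<cdot>\<^sub>m T)"
      unfolding l_def mult_smult_assoc_mat[OF kc Vc] kV mult_smult_distrib[OF gc(1) Tc] ..
    then have "flag ?n (cols (l * V)) = flag ?n (cols g)"
      using flag_cols_mult_borel[OF gc(1) borel_GL_smult[OF T(1) a(1)]] by simp
    then show "\<exists>l\<in>levi_SL p q. flag ?n (cols g) = flag ?n (cols (l * V))"
      using l by metis
  qed
  finally show ?thesis .
qed

text \<open>As \<open>m\<close> intertwines \<open>D\<close> with \<open>sign_mat n K\<close>, it
  carries the 1-eigenspace of the former onto that of the latter.\<close>

lemma image_coord_space_of_conj:
  fixes m :: "complex mat"
  assumes m: "m \<in> carrier_mat n n" "det m \<noteq> 0"
    and S: "\<And>x. x \<in> carrier_vec n \<Longrightarrow> D *\<^sub>v x = x \<longleftrightarrow> x \<in> coord_space n J"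
    and D: "D \<in> carrier_mat n n" "sign_mat n K * m = m * D"
  shows "(\<lambda>v. m *\<^sub>v v) ` coord_space n J = coord_space n K"
proof -
  obtain m' where m': "m' \<in> carrier_mat n n" "m * m' = 1\<^sub>m n" "m' * m = 1\<^sub>m n"
    using obtain_inverse_mat[OF m] by metis
  have step: "sign_mat n K *\<^sub>v (m *\<^sub>v x) = m *\<^sub>v (D *\<^sub>v x)" if "x \<in> carrier_vec n" for x
    using assoc_mult_mat_vec[OF sign_mat_carrier m(1) that, of K] assoc_mult_mat_vec[OF m(1) D(1) that] D(2) by simp
  show ?thesis
  proof (intro equalityI subsetI)
    fix w assume "w \<in> (\<lambda>v. m *\<^sub>v v) ` coord_space n J"
    then obtain x where x: "x \<in> coord_space n J" "w = m *\<^sub>v x" by auto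
    note xc = coord_space_carrier[OF x(1)]
    have "sign_mat n K *\<^sub>v w = w"
      unfolding x(2) step[OF xc] using S[OF xc] x(1) by simp
    then show "w \<in> coord_space n K"
      using sign_mat_fix_iff[of w n K] mult_mat_vec_carrier[OF m(1) xc] x(2) by simp
  next
    fix w assume w: "w \<in> (coord_space n K :: complex vec set)"
    note wc = coord_space_carrier[OF w]
    define x where "x = m' *\<^sub>v w"
    have xc: "x \<in> carrier_vec n"
      using m'(1) wc by (simp add: x_def)
    have mx: "m *\<^sub>v x = w"
      unfolding x_def using assoc_mult_mat_vec[OF m(1) m'(1) wc] m'(2) wc by simp
    have "m *\<^sub>v (D *\<^sub>v x) = m *\<^sub>v x"
      using step[OF xc] sign_mat_fix_iff[OF wc, of K] w unfolding mx by simp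
    then have "m' *\<^sub>v (m *\<^sub>v (D *\<^sub>v x)) = m' *\<^sub>v (m *\<^sub>v x)" by simp
    then have "D *\<^sub>v x = x"
      using assoc_mult_mat_vec[OF m'(1) m(1), symmetric] m'(3) xc D(1) by simp
    then show "w \<in> (\<lambda>v. m *\<^sub>v v) ` coord_space n J"
      using S[OF xc] mx by blast
  qed
qed

text \<open>Rows of \<open>pair_mat c\<close> outside \<open>plus_set c\<close> are zero, so there
  the equation reads \<open>- x $ i = x $ i\<close>. Columns inside are zero as well, so vectors
  supported on \<open>plus_set c\<close> are fixed.\<close>

lemma sign_mat_plus_pair_fix_iff:
  assumes c: "matched c" "length c = n" and x: "x \<in> carrier_vec n"
  shows "(sign_mat n (plus_set c) + pair_mat c) *\<^sub>v x = x \<longleftrightarrow> x \<in> coord_space n (plus_set c)"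
proof -
  let ?J = "plus_set c" and ?S = "sign_mat n (plus_set c) :: complex mat"
  have pc: "pair_mat c \<in> carrier_mat n n"
    using c by (simp add: pair_mat_def)
  have Dx: "(?S + pair_mat c) *\<^sub>v x = ?S *\<^sub>v x + pair_mat c *\<^sub>v x"
    by (rule add_mult_distrib_mat_vec[OF sign_mat_carrier pc x])
  have Dc: "(?S + pair_mat c) *\<^sub>v x \<in> carrier_vec n"
    using pc x mult_mat_vec_carrier[of "?S + pair_mat c" n n x] by simp
  have pair: "pair_mat c $$ (i, j) = 0" if "i < n" "j < n" "i \<notin> ?J \<or> j \<in> ?J" for i j
    using that plus_set_mate[OF c(1), of j] c(2) by (auto simp: pair_mat_def)
  have entry: "((?S + pair_mat c) *\<^sub>v x) $ i = (if i \<in> ?J then x $ i else - x $ i) + (\<Sum>j<n. pair_mat c $$ (i, j) * x $ j)"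
    if "i < n" for i
    unfolding Dx using that sign_mat_mult_vec_entry[OF x that, of ?J] mult_vec_entry[OF pc x that] pc x
    by simp
  show ?thesis
  proof
    assume fix_x: "(?S + pair_mat c) *\<^sub>v x = x"
    have "x $ i = 0" if "i < n" "i \<notin> ?J" for i
    proof -
      have "(\<Sum>j<n. pair_mat c $$ (i, j) * x $ j) = 0"
        using pair that by (intro sum.neutral) auto
      then have "- x $ i = x $ i"
        using entry[OF that(1)] fix_x that(2) by simp
      then show ?thesis by simp
    qed
    then show "x \<in> coord_space n ?J"
      using x by (simp add: coord_space_def)
  next
    assume J: "x \<in> coord_space n ?J"
    have "(\<Sum>j<n. pair_mat c $$ (i, j) * x $ j) = 0" if "i < n" for i
    proof (rule sum.neutral, rule ballI)
      fix j assume "j \<in> {..<n}"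
      then show "pair_mat c $$ (i, j) * x $ j = 0"
        using pair[OF that, of j] J by (cases "j \<in> ?J") (auto simp: coord_space_def)
    qed
    then have "((?S + pair_mat c) *\<^sub>v x) $ i = x $ i" if "i < n" for i
      using entry[OF that] J that by (auto simp: coord_space_def)
    then show "(?S + pair_mat c) *\<^sub>v x = x"
      using carrier_vecD[OF x] carrier_vecD[OF Dc] by (intro eq_vecI) simp_all
  qed
qed

text \<open>Passing from \<open>clan_mat c\<close> to the sign matrix plus pairs makes the
  1-eigenspace a coordinate subspace. Then \<open>m = g * T * U\<close> maps it onto
  \<open>coord_space (p + q) {..<p}\<close>, and applying the inverse of \<open>g\<close> leaves
  \<open>T * U\<close>.\<close>

lemma conj_clan_mat_imp_image:
  assumes c: "c \<in> clan_seqs p q" and g: "g \<in> carrier (SL (p + q))"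
    and T: "T \<in> borel_GL (p + q)" "sign_mat (p + q) {..<p} * (g * T) = (g * T) * clan_mat c"
  obtains U where "U \<in> borel_GL (p + q)"
    "(\<lambda>v. inv\<^bsub>SL (p + q)\<^esub> g *\<^sub>v v) ` coord_space (p + q) {..<p} = (\<lambda>v. U *\<^sub>v v) ` coord_space (p + q) (plus_set c)"
proof -
  let ?n = "p + q" and ?t = "sign_mat (p + q) {..<p} :: complex mat"
  let ?D = "sign_mat ?n (plus_set c) + pair_mat c"
  note cD = clan_seqsD[OF c]
  obtain U where U: "U \<in> borel_GL ?n" "U * ?D = clan_mat c * U"
    using clan_mat_conj_sign_plus_pair[OF cD(2)] cD(1) by metis
  note Tc = borel_GLD(1,3)[OF T(1)] and Uc = borel_GLD(1,3)[OF U(1)] and tc = sign_mat_carrier[of ?n "{..<p}"]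
  have gc: "g \<in> carrier_mat ?n ?n" "det g = 1" using g by (auto simp: carrier_SL_iff)
  have Dc: "?D \<in> carrier_mat ?n ?n" using cD by (simp add: pair_mat_def)
  have Mc: "clan_mat c \<in> carrier_mat ?n ?n"
    using clan_mat_carrier[of c] cD by simp
  define m where "m = (g * T) * U"
  have gT: "g * T \<in> carrier_mat ?n ?n" using gc Tc by simp
  have m: "m \<in> carrier_mat ?n ?n" "det m \<noteq> 0"
    unfolding m_def det_mult[OF gT Uc(1)] det_mult[OF gc(1) Tc(1)] using gT gc Tc Uc by simp_all
  have "?t * m = (?t * (g * T)) * U"
    unfolding m_def using assoc_mult_mat[OF tc gT Uc(1)] by simp
  also have "\<dots> = (g * T) * (clan_mat c * U)"
    unfolding T(2) by (rule assoc_mult_mat[OF gT Mc Uc(1)])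
  also have "\<dots> = m * ?D"
    unfolding U(2)[symmetric] m_def using assoc_mult_mat[OF gT Uc(1) Dc] by simp
  finally have tm: "?t * m = m * ?D" .
  have im: "(\<lambda>v. m *\<^sub>v v) ` coord_space ?n (plus_set c) = coord_space ?n {..<p}"
    using image_coord_space_of_conj[OF m sign_mat_plus_pair_fix_iff[OF cD(2,1)] Dc tm] .
  define h where "h = inv\<^bsub>SL ?n\<^esub> g"
  have h: "h \<in> carrier_mat ?n ?n" "h * g = 1\<^sub>m ?n"
    using inv_SL[OF g] by (auto simp: h_def carrier_SL_iff)
  have "h * m = (h * g) * (T * U)"
    using h(1) gc(1) Tc(1) Uc(1) by (simp add: m_def assoc_mult_mat[of _ ?n ?n _ ?n _ ?n])
  then have hm: "h * m = T * U"
    using h(2) Tc(1) Uc(1) by simp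
  have "(\<lambda>v. h *\<^sub>v v) ` coord_space ?n {..<p} = (\<lambda>v. (T * U) *\<^sub>v v) ` coord_space ?n (plus_set c)"
    unfolding im[symmetric] image_coord_space_mult[OF h(1) m(1), symmetric] hm ..
  with that borel_GL_mult[OF T(1) U(1)] show ?thesis
    unfolding h_def by blast
qed

text \<open>With \<open>m = g * b\<close>, the conjugate \<open>A\<close> of \<theta> by
  \<open>m\<close> has \<open>coord_space (p + q) J\<close> as its 1-eigenspace. This forces the
  form sign matrix plus strict block, to which the normal form applies.\<close>

lemma image_imp_conj_clan_mat:
  assumes g: "g \<in> carrier (SL (p + q))" and J: "J \<subseteq> {..<p + q}" "card J = p"
    and b: "b \<in> borel_GL (p + q)"
      "(\<lambda>v. inv\<^bsub>SL (p + q)\<^esub> g *\<^sub>v v) ` coord_space (p + q) {..<p} = (\<lambda>v. b *\<^sub>v v) ` coord_space (p + q) J"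
  obtains c T where "c \<in> clan_seqs p q" "plus_set c = J" "T \<in> borel_GL (p + q)"
    "sign_mat (p + q) {..<p} * (g * T) = (g * T) * clan_mat c"
proof -
  let ?n = "p + q" and ?t = "sign_mat (p + q) {..<p} :: complex mat"
  note bc = borel_GLD(1,3)[OF b(1)] and tc = sign_mat_carrier[of ?n "{..<p}"]
  have gc: "g \<in> carrier_mat ?n ?n" "det g = 1" using g by (auto simp: carrier_SL_iff)
  define h where "h = inv\<^bsub>SL ?n\<^esub> g"
  have h: "h \<in> carrier_mat ?n ?n" "g * h = 1\<^sub>m ?n"
    using inv_SL[OF g] by (auto simp: h_def carrier_SL_iff)
  define m where "m = g * b"
  have m: "m \<in> carrier_mat ?n ?n" "det m \<noteq> 0"
    using gc bc by (auto simp: m_def det_mult[OF gc(1) bc(1)])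
  obtain m' where m': "m' \<in> carrier_mat ?n ?n" "m * m' = 1\<^sub>m ?n" "m' * m = 1\<^sub>m ?n"
    using obtain_inverse_mat[OF m] by metis
  have im: "(\<lambda>v. m *\<^sub>v v) ` coord_space ?n J = coord_space ?n {..<p}"
    unfolding m_def image_coord_space_mult[OF gc(1) bc(1)] b(2)[symmetric] h_def[symmetric]
      image_coord_space_mult[OF gc(1) h(1), symmetric] h(2) by (rule image_coord_space_one)
  define A where "A = m' * (?t * m)"
  have tm: "?t * m \<in> carrier_mat ?n ?n"
    by (rule mult_carrier_mat[OF tc m(1)])
  have Ac: "A \<in> carrier_mat ?n ?n"
    using m'(1) tm by (simp add: A_def)
  have mA: "m * A = ?t * m"
    unfolding A_def assoc_mult_mat[OF m(1) m'(1) tm, symmetric] m'(2) by (rule left_mult_one_mat[OF tm])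
  have Av: "A *\<^sub>v x = m' *\<^sub>v (?t *\<^sub>v (m *\<^sub>v x))" if "x \<in> carrier_vec ?n" for x
    unfolding A_def using assoc_mult_mat_vec[OF m'(1) tm that] assoc_mult_mat_vec[OF tc m(1) that] by simp
  have m'm: "m' *\<^sub>v (m *\<^sub>v x) = x" if "x \<in> carrier_vec ?n" for x
    using assoc_mult_mat_vec[OF m'(1) m(1) that] m'(3) that by simp
  have unit: "A *\<^sub>v unit_vec ?n j = col A j" if "j < ?n" for j
    using Ac that by (auto simp: mult_mat_vec_def intro!: eq_vecI)
  \<comment> \<open>The matrix \<open>m\<close> sends unit vectors with index in \<open>J\<close>
    into the 1-eigenspace of \<theta>, so \<open>A\<close> fixes them.\<close>
  have colJ: "col A j = unit_vec ?n j" if "j \<in> J" "j < ?n" for j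
  proof -
    have "m *\<^sub>v unit_vec ?n j \<in> coord_space ?n {..<p}"
      using im unit_vec_in_coord_space[OF that(1), of ?n] by blast
    then have "?t *\<^sub>v (m *\<^sub>v unit_vec ?n j) = m *\<^sub>v unit_vec ?n j"
      using sign_mat_fix_iff[OF coord_space_carrier] by blast
    then show ?thesis
      using Av[of "unit_vec ?n j"] m'm[of "unit_vec ?n j"] unit[OF that(2)] by simp
  qed
  \<comment> \<open>The image of \<theta> + 1 lies in the 1-eigenspace of \<theta>; transported by
    \<open>m\<close>, the image of \<open>A\<close> + 1 lies in
    \<open>coord_space ?n J\<close>.\<close>
  have rowJ: "A *\<^sub>v x + x \<in> coord_space ?n J" if x: "x \<in> carrier_vec ?n" for x
  proof -
    define v where "v = m *\<^sub>v x"
    have v: "v \<in> carrier_vec ?n" "?t *\<^sub>v v \<in> carrier_vec ?n"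
      using m(1) x mult_mat_vec_carrier[OF tc, of v] by (auto simp: v_def)
    have "?t *\<^sub>v v + v \<in> coord_space ?n {..<p}"
      using v sign_mat_mult_vec_entry[OF v(1), of _ "{..<p}"] by (auto simp: coord_space_def)
    then obtain y where y: "y \<in> coord_space ?n J" "?t *\<^sub>v v + v = m *\<^sub>v y"
      unfolding im[symmetric] by auto
    have "m' *\<^sub>v (?t *\<^sub>v v + v) = y"
      unfolding y(2) by (rule m'm[OF coord_space_carrier[OF y(1)]])
    moreover have "m' *\<^sub>v (?t *\<^sub>v v + v) = A *\<^sub>v x + x"
      unfolding mult_add_distrib_mat_vec[OF m'(1) v(2,1)] unfolding Av[OF x] v_def m'm[OF x] ..
    ultimately show ?thesis
      using y(1) by simp
  qed
  define N where "N = A - sign_mat ?n J"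
  have AN: "A = sign_mat ?n J + N"
    unfolding N_def using Ac by (intro eq_matI) (auto simp: sign_mat_def)
  have "N $$ (i, j) = 0" if "i < ?n" "j < ?n" "i \<notin> J \<or> j \<in> J" for i j
  proof (cases "j \<in> J")
    case True
    then have "A $$ (i, j) = (if i = j then 1 else 0)"
      using arg_cong[OF colJ[OF True that(2)], of "\<lambda>v. v $ i"] that(1,2) Ac by simp
    then show ?thesis
      using that True Ac by (auto simp: N_def sign_mat_def)
  next
    case False
    then have "(A *\<^sub>v unit_vec ?n j + unit_vec ?n j) $ i = 0"
      using rowJ[of "unit_vec ?n j"] that by (auto simp: coord_space_def)
    then have "A $$ (i, j) + (if i = j then 1 else 0) = 0"
      unfolding unit[OF that(2)] using that(1,2) Ac by simp
    then show ?thesis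
      using that False Ac by (auto simp: N_def sign_mat_def add_eq_0_iff2 split: if_splits)
  qed
  then have "block_strict ?n J N"
    using minus_carrier_mat[OF sign_mat_carrier, of A ?n J] by (auto simp: block_strict_def N_def)
  then obtain c U where c: "c \<in> clan_seqs p q" "plus_set c = J" and U: "U \<in> borel_GL ?n" "U * A = clan_mat c * U"
    using sign_mat_plus_block_strict_normal_form[OF J] AN by metis
  \<comment> \<open>The normal form conjugates in the direction opposite to the claim, so the
    required triangular matrix is \<open>b\<close> times the inverse of \<open>U\<close>.\<close>
  obtain R where R: "R \<in> borel_GL ?n" "U * R = 1\<^sub>m ?n" "R * U = 1\<^sub>m ?n"
    using borel_GL_inverse[OF U(1)] .
  note Uc = borel_GLD(1)[OF U(1)] and Rc = borel_GLD(1)[OF R(1)]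
  have Mc: "clan_mat c \<in> carrier_mat ?n ?n"
    using clan_mat_carrier[of c] clan_seqsD[OF c(1)] by simp
  have "R * clan_mat c = R * (clan_mat c * U) * R"
    using Rc Mc Uc R(2) by (simp add: assoc_mult_mat[of _ ?n ?n _ ?n _ ?n])
  also have "\<dots> = (R * U) * A * R"
    unfolding U(2)[symmetric] using Rc Uc Ac by (simp add: assoc_mult_mat[of _ ?n ?n _ ?n _ ?n])
  also have "\<dots> = A * R"
    unfolding R(3) using Ac by simp
  finally have RM: "R * clan_mat c = A * R" .
  have gbR: "g * (b * R) = m * R"
    unfolding m_def using assoc_mult_mat[OF gc(1) bc(1) Rc] by simp
  have "?t * (m * R) = (m * A) * R"
    unfolding mA using assoc_mult_mat[OF tc m(1) Rc] by simp
  also have "\<dots> = m * (R * clan_mat c)"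
    unfolding RM by (rule assoc_mult_mat[OF m(1) Ac Rc])
  also have "\<dots> = (m * R) * clan_mat c"
    using assoc_mult_mat[OF m(1) Rc Mc] by simp
  finally have "?t * (g * (b * R)) = (g * (b * R)) * clan_mat c"
    unfolding gbR .
  with that c borel_GL_mult[OF b(1) R(1)] show ?thesis by blast
qed

text \<open>Since \<open>l\<close> commutes with \<theta>, \<open>g\<close> and \<open>l * g\<close>
  define the same involution. The two clan matrices are then conjugate by the inverse of
  \<open>S\<close> times \<open>T\<close>, and \<open>clan_mat_conj_relabelling\<close>
  applies.\<close>

lemma conj_clan_mat_unique:
  assumes c: "c \<in> clan_seqs p q" and d: "d \<in> clan_seqs p q"
    and g: "g \<in> carrier (SL (p + q))" and l: "l \<in> levi_SL p q"
    and T: "T \<in> borel_GL (p + q)" "sign_mat (p + q) {..<p} * (g * T) = (g * T) * clan_mat c"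
    and S: "S \<in> borel_GL (p + q)" "sign_mat (p + q) {..<p} * (l * g * S) = (l * g * S) * clan_mat d"
  shows "(c, d) \<in> relabelling"
proof -
  let ?n = "p + q" and ?t = "sign_mat (p + q) {..<p} :: complex mat"
  note Tc = borel_GLD(1,3)[OF T(1)] and Sc = borel_GLD(1,3)[OF S(1)] and tc = sign_mat_carrier[of ?n "{..<p}"]
  have gc: "g \<in> carrier_mat ?n ?n" "det g = 1" using g by (auto simp: carrier_SL_iff)
  have lc: "l \<in> carrier_mat ?n ?n" "det l = 1" "?t * l = l * ?t" using l by (auto simp: levi_SL_iff)
  have Mc: "clan_mat c \<in> carrier_mat ?n ?n" "clan_mat d \<in> carrier_mat ?n ?n"
    using clan_mat_carrier[of c] clan_mat_carrier[of d] clan_seqsD[OF c] clan_seqsD[OF d] by auto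
  obtain S' where S': "S' \<in> borel_GL ?n" "S * S' = 1\<^sub>m ?n"
    using borel_GL_inverse[OF S(1)] by metis
  note S'c = borel_GLD(1)[OF S'(1)]
  define k where "k = l * g * S"
  define U where "U = S' * T"
  have U: "U \<in> borel_GL ?n"
    unfolding U_def by (rule borel_GL_mult[OF S'(1) T(1)])
  note Uc = borel_GLD(1)[OF U]
  have lg: "l * g \<in> carrier_mat ?n ?n" and gT: "g * T \<in> carrier_mat ?n ?n" and kc: "k \<in> carrier_mat ?n ?n"
    using lc gc Tc Sc by (auto simp: k_def)
  have dk: "det k \<noteq> 0"
    unfolding k_def det_mult[OF lg Sc(1)] det_mult[OF lc(1) gc(1)] using lc gc Sc by simp
  have "k * U = l * g * (S * S') * T"
    unfolding k_def U_def using lc(1) gc(1) Sc(1) S'c Tc(1) by (simp add: assoc_mult_mat[of _ ?n ?n _ ?n _ ?n])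
  then have kU: "k * U = l * (g * T)"
    using S'(2) lc(1) gc(1) Tc(1) by (simp add: assoc_mult_mat[of _ ?n ?n _ ?n _ ?n])
  have "k * (U * clan_mat c) = l * ((g * T) * clan_mat c)"
    using assoc_mult_mat[OF kc Uc Mc(1)] assoc_mult_mat[OF lc(1) gT Mc(1)] kU by simp
  also have "\<dots> = (l * ?t) * (g * T)"
    unfolding T(2)[symmetric] using assoc_mult_mat[OF lc(1) tc gT] by simp
  also have "\<dots> = ?t * (k * U)"
    unfolding lc(3)[symmetric] kU by (rule assoc_mult_mat[OF tc lc(1) gT])
  also have "\<dots> = (k * clan_mat d) * U"
    using assoc_mult_mat[OF tc kc Uc] S(2) by (simp add: k_def)
  also have "\<dots> = k * (clan_mat d * U)"
    by (rule assoc_mult_mat[OF kc Mc(2) Uc])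
  finally have "U * clan_mat c = clan_mat d * U"
    by (rule mult_left_cancel_mat[OF kc dk mult_carrier_mat[OF Uc Mc(1)] mult_carrier_mat[OF Mc(2) Uc]])
  then show ?thesis
    using clan_mat_conj_relabelling[of c d U] U clan_seqsD[OF c] clan_seqsD[OF d] by simp
qed

theorem theorem4p15:
  fixes p q n :: nat and I :: "complex vec set"
  assumes "p > 0" and "q > 0" and "n = p + q"
    and "I \<subseteq> set (unit_vecs n)" and "card I = p"
  shows "{X \<in> lcosets\<^bsub>SL n\<^esub> (levi_SL p q). proj_LP p q X \<in> schubert_cell p q I}
           = (\<Union>\<gamma>\<in>sect p q (clan_of_subset n I). orbit_R p q \<gamma>)
       \<and> disjoint_family_on (orbit_R p q) (sect p q (clan_of_subset n I))"
proof -
  define J where "J = {i. i < n \<and> unit_vec n i \<in> I}"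
  have J: "J \<subseteq> {..<p + q}"
    using assms(3) by (auto simp: J_def)
  have I: "I = unit_vec (p + q) ` J"
    using assms(3,4) by (auto simp: J_def unit_vecs_def)
  have "inj_on (unit_vec (p + q) :: nat \<Rightarrow> complex vec) J"
    using J by (auto intro!: inj_onI simp: unit_vec_eq)
  then have cJ: "card J = p"
    using assms(5) card_image[of "unit_vec (p + q) :: nat \<Rightarrow> complex vec" J] I by simp
  have pq: "p + q > 0"
    using assms(1) by simp
  have sect: "sect p q (clan_of_subset n I) = clan_of ` {c \<in> clan_seqs p q. plus_set c = J}"
    unfolding assms(3) sect_clan_of_subset by (simp add: J_def assms(3))
  \<comment> \<open>Membership in an orbit becomes a matrix equation; the cardinality required by
    \<open>coset_in_orbit_Q_seq_iff\<close> is \<open>cJ\<close>.\<close>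
  have R: "X \<in> orbit_R p q (clan_of c) \<longleftrightarrow> (\<exists>g\<in>carrier (SL n). X = inv\<^bsub>SL n\<^esub> g <#\<^bsub>SL n\<^esub> levi_SL p q \<and>
      (\<exists>T\<in>borel_GL n. sign_mat n {..<p} * (g * T) = (g * T) * clan_mat c))"
    if "c \<in> clan_seqs p q" "plus_set c = J" for X c
    unfolding orbit_R_def orbit_Q_clan_of[OF that(1)] assms(3)
    using coset_in_orbit_Q_seq_iff[OF that(1) _ pq] that(2) cJ by auto
  have "X \<in> lcosets\<^bsub>SL n\<^esub> (levi_SL p q) \<and> proj_LP p q X \<in> schubert_cell p q I \<longleftrightarrow>
    (\<exists>c\<in>clan_seqs p q. plus_set c = J \<and> X \<in> orbit_R p q (clan_of c))" for X
  proof
    assume X: "X \<in> lcosets\<^bsub>SL n\<^esub> (levi_SL p q) \<and> proj_LP p q X \<in> schubert_cell p q I"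
    then obtain a where a: "a \<in> carrier (SL n)" "X = a <#\<^bsub>SL n\<^esub> levi_SL p q"
      by (auto simp: LCOSETS_def)
    \<comment> \<open>Elements of \<open>orbit_R\<close> are cosets of inverses, so the conjugacy
      condition concerns the inverse of the representative \<open>a\<close>.\<close>
    define g where "g = inv\<^bsub>SL n\<^esub> a"
    have g: "g \<in> carrier (SL n)" "inv\<^bsub>SL n\<^esub> g = a"
      using inv_SL[OF a(1)] by (auto simp: g_def)
    have "a <#\<^bsub>SL n\<^esub> parabolic_SL p q \<in> schubert_cell p q (unit_vec (p + q) ` J)"
      using X a proj_LP_coset[of a p q] I assms(3) by simp
    then obtain b where "b \<in> borel_GL n" "(\<lambda>v. a *\<^sub>v v) ` coord_space n {..<p} = (\<lambda>v. b *\<^sub>v v) ` coord_space n J"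
      using coset_in_schubert_cell_iff[OF _ J pq] a(1) assms(3) by auto
    then obtain c T where c: "c \<in> clan_seqs p q" "plus_set c = J" and "T \<in> borel_GL n"
      "sign_mat n {..<p} * (g * T) = (g * T) * clan_mat c"
      using image_imp_conj_clan_mat[OF _ J cJ, of g b] g assms(3) by metis
    then have "X \<in> orbit_R p q (clan_of c)"
      unfolding R[OF c] using a(2) g by auto
    with c show "\<exists>c\<in>clan_seqs p q. plus_set c = J \<and> X \<in> orbit_R p q (clan_of c)"
      by blast
  next
    assume "\<exists>c\<in>clan_seqs p q. plus_set c = J \<and> X \<in> orbit_R p q (clan_of c)"
    then obtain c where c: "c \<in> clan_seqs p q" "plus_set c = J" "X \<in> orbit_R p q (clan_of c)"
      by blast
    then obtain g T where g: "g \<in> carrier (SL n)" "X = inv\<^bsub>SL n\<^esub> g <#\<^bsub>SL n\<^esub> levi_SL p q"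
      and T: "T \<in> borel_GL n" "sign_mat n {..<p} * (g * T) = (g * T) * clan_mat c"
      using R by blast
    note h = inv_SL(1)[OF g(1)]
    obtain U where "U \<in> borel_GL n"
      "(\<lambda>v. inv\<^bsub>SL n\<^esub> g *\<^sub>v v) ` coord_space n {..<p} = (\<lambda>v. U *\<^sub>v v) ` coord_space n J"
      using conj_clan_mat_imp_image[OF c(1)] g(1) T c(2) assms(3) by metis
    then have "inv\<^bsub>SL n\<^esub> g <#\<^bsub>SL n\<^esub> parabolic_SL p q \<in> schubert_cell p q I"
      using coset_in_schubert_cell_iff[OF _ J pq] h I assms(3) by auto
    then show "X \<in> lcosets\<^bsub>SL n\<^esub> (levi_SL p q) \<and> proj_LP p q X \<in> schubert_cell p q I"
      using h proj_LP_coset[of "inv\<^bsub>SL n\<^esub> g" p q] g(2) assms(3) by (auto simp: LCOSETS_def)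
  qed
  then have "{X \<in> lcosets\<^bsub>SL n\<^esub> (levi_SL p q). proj_LP p q X \<in> schubert_cell p q I}
      = (\<Union>\<gamma>\<in>sect p q (clan_of_subset n I). orbit_R p q \<gamma>)"
    unfolding sect by auto
  moreover have "disjoint_family_on (orbit_R p q) (sect p q (clan_of_subset n I))"
    unfolding disjoint_family_on_def sect
  proof (intro ballI impI)
    fix \<gamma> \<delta> assume "\<gamma> \<in> clan_of ` {c \<in> clan_seqs p q. plus_set c = J}"
      "\<delta> \<in> clan_of ` {c \<in> clan_seqs p q. plus_set c = J}" and neq: "\<gamma> \<noteq> \<delta>"
    then obtain c d where c: "c \<in> clan_seqs p q" "plus_set c = J" "\<gamma> = clan_of c"
      and d: "d \<in> clan_seqs p q" "plus_set d = J" "\<delta> = clan_of d" by blast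
    show "orbit_R p q \<gamma> \<inter> orbit_R p q \<delta> = {}"
    proof (rule ccontr)
      assume "orbit_R p q \<gamma> \<inter> orbit_R p q \<delta> \<noteq> {}"
      then obtain X where "X \<in> orbit_R p q (clan_of c)" "X \<in> orbit_R p q (clan_of d)"
        using c d by blast
      then obtain g T g' S where g: "g \<in> carrier (SL n)" "X = inv\<^bsub>SL n\<^esub> g <#\<^bsub>SL n\<^esub> levi_SL p q"
        and T: "T \<in> borel_GL n" "sign_mat n {..<p} * (g * T) = (g * T) * clan_mat c"
        and g': "g' \<in> carrier (SL n)" "X = inv\<^bsub>SL n\<^esub> g' <#\<^bsub>SL n\<^esub> levi_SL p q"
        and S: "S \<in> borel_GL n" "sign_mat n {..<p} * (g' * S) = (g' * S) * clan_mat d"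
        using R[OF c(1,2)] R[OF d(1,2)] by metis
      note h = inv_SL[OF g(1)] and h' = inv_SL[OF g'(1)]
      have carr: "g \<in> carrier_mat n n" "g' \<in> carrier_mat n n" "inv\<^bsub>SL n\<^esub> g \<in> carrier_mat n n"
        "inv\<^bsub>SL n\<^esub> g' \<in> carrier_mat n n"
        using g(1) g'(1) h(1) h'(1) by (auto simp: carrier_SL_iff)
      \<comment> \<open>Equal Levi cosets of the two inverses differ by a right factor
        \<open>l\<close>, which after inversion becomes a left factor:
        \<open>g' = l * g\<close>.\<close>
      have "inv\<^bsub>SL n\<^esub> g \<in> inv\<^bsub>SL n\<^esub> g <#\<^bsub>SL n\<^esub> levi_SL p q"
        unfolding l_coset_SL
        by (rule image_eqI[OF _ one_levi_SL]) (use carr(3) assms(3) in simp)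
      then obtain l where l: "l \<in> levi_SL p q" "inv\<^bsub>SL n\<^esub> g = inv\<^bsub>SL n\<^esub> g' * l"
        using g(2) g'(2) unfolding l_coset_SL by blast
      have lc: "l \<in> carrier_mat n n"
        using l(1) assms(3) by (simp add: levi_SL_iff)
      have "g' = g' * (inv\<^bsub>SL n\<^esub> g * g)"
        unfolding h(2) using carr(2) by simp
      also have "\<dots> = (g' * inv\<^bsub>SL n\<^esub> g') * l * g"
        unfolding l(2) using carr lc by (simp add: assoc_mult_mat[of _ n n _ n _ n])
      also have "\<dots> = l * g"
        unfolding h'(3) using lc by simp
      finally have g'_eq: "g' = l * g" .
      have "(c, d) \<in> relabelling"
        using conj_clan_mat_unique[OF c(1) d(1) _ l(1)] g(1) T S assms(3) unfolding g'_eq by blast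
      then show False
        using neq c(3) d(3) clan_of_eq_iff by blast
    qed
  qed
  ultimately show ?thesis by blast
qed

end
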